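(* The property of being a maximal Tjurina curve is not determined by the combinatorics of a line arrangement. More precisely, let $\mathcal{A}_f: f=0$ and $\mathcal{A}_g: g=0$ be the arrangements of ten lines in $\mathbb{P}^2$ given by $$f=(y-z)(y+2z)(2y+z)(x-2y-z)(x-y-2z)(x-y+z)(x+y-z)(x+y+2z)(2x-y-2z)(x-3y-z),$$ $$g=xz(x-y)(x+y)(x-y-z)(y+z)(x-z)(x+y+2z)(x-2y-z)(x-3y-z).$$ Then $\mathcal{A}_f$ and $\mathcal{A}_g$ have isomorphic intersection lattices, $\mathcal{A}_g$ is a maximal Tjurina curve with $d=10$ and $r=6$, and $\mathcal{A}_f$ is not a maximal Tjurina curve.
   Context: $S=\mathbb{C}[x,y,z]$ with the standard grading. For a line arrangement $\mathcal{A}: h=0$ in $\mathbb{P}^2=\mathbb{P}^2_{\mathbb{C}}$ of $d$ lines (with $h$ a product of $d$ pairwise non-proportional linear forms), the intersection lattice is that of the corresponding central arrangement of planes in $\mathbb{C}^3$; with $n_k$ the number of points lying on exactly $k$ lines, the total Tjurina number is $\tau(\mathcal{A})=\sum_{k\geq 2}n_k(k-1)^2$. Let $AR(h)=\{(\alpha,\beta,\gamma)\in S^3:\alpha h_x+\beta h_y+\gamma h_z=0\}$, graded by the common degree of $\alpha,\beta,\gamma$, and $r=\mathrm{mdr}(h)=\min\{q\geq 0: AR(h)_q\neq 0\}$. The curve $\mathcal{A}$ is a maximal Tjurina curve if $2r\geq d$ and $\tau(\mathcal{A})=(d-1)^2-r(d-r-1)-\binom{2r+2-d}{2}$. *)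

theory Defs
  imports "HOL-Analysis.Analysis" "HOL-Computational_Algebra.Computational_Algebra"
begin

text \<open>
  The polynomial ring \<open>S = \<complex>[x,y,z]\<close> is the iterated ring \<open>\<complex>[x][y][z]\<close>: the outermost
  variable is \<open>z\<close>, the innermost one is \<open>x\<close>.
\<close>

type_synonym poly3 = "complex poly poly poly"

definition const3 :: "complex \<Rightarrow> poly3"
  where "const3 c = [:[:[:c:]:]:]"

definition var_x :: poly3 where "var_x = [:[:[:0, 1:]:]:]"

definition var_y :: poly3 where "var_y = [:[:0, 1:]:]"

definition var_z :: poly3 where "var_z = [:0, 1:]"

definition coeff3 :: "poly3 \<Rightarrow> nat \<Rightarrow> nat \<Rightarrow> nat \<Rightarrow> complex"
  where "coeff3 h i j k = coeff (coeff (coeff h k) j) i"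

definition eval3 :: "poly3 \<Rightarrow> complex ^ 3 \<Rightarrow> complex"
  where "eval3 h v = poly (poly (poly h [:[:v $ 3:]:]) [:v $ 2:]) (v $ 1)"

definition diff_x :: "poly3 \<Rightarrow> poly3" where "diff_x h = map_poly (map_poly pderiv) h"

definition diff_y :: "poly3 \<Rightarrow> poly3" where "diff_y h = map_poly pderiv h"

definition diff_z :: "poly3 \<Rightarrow> poly3" where "diff_z h = pderiv h"

text \<open>The zero polynomial is homogeneous of every degree.\<close>

definition homogeneous :: "nat \<Rightarrow> poly3 \<Rightarrow> bool"
  where "homogeneous q h \<longleftrightarrow> (\<forall>i j k. coeff3 h i j k \<noteq> 0 \<longrightarrow> i + j + k = q)"

definition linear_form :: "poly3 \<Rightarrow> bool"
  where "linear_form l \<longleftrightarrow> homogeneous 1 l \<and> l \<noteq> 0"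

definition proportional :: "poly3 \<Rightarrow> poly3 \<Rightarrow> bool"
  where "proportional l m \<longleftrightarrow> (\<exists>c. c \<noteq> 0 \<and> m = const3 c * l)"

definition line_arrangement :: "nat \<Rightarrow> poly3 \<Rightarrow> bool"
  where "line_arrangement d h \<longleftrightarrow>
    (\<exists>L. finite L \<and> card L = d \<and> (\<forall>l\<in>L. linear_form l) \<and>
         (\<forall>l\<in>L. \<forall>m\<in>L. l \<noteq> m \<longrightarrow> \<not> proportional l m) \<and> h = \<Prod>L)"

text \<open>
  Points of \<open>\<P>\<^sup>2\<close> are one-dimensional subspaces of \<open>\<complex>\<^sup>3\<close>, and a line of \<open>\<P>\<^sup>2\<close> is
  identified with the corresponding plane through the origin in \<open>\<complex>\<^sup>3\<close>; a point lies on a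
  line iff it is contained in it as a subspace.  The function \<open>lines\<close> is used for products of
  pairwise non-proportional linear forms.
\<close>

definition proj_plane :: "(complex ^ 3) set set"
  where "proj_plane = {vec.span {v} |v. v \<noteq> 0}"

definition lines :: "poly3 \<Rightarrow> (complex ^ 3) set set"
  where "lines h = {{v. eval3 l v = 0} |l. linear_form l \<and> l dvd h}"

text \<open>
  The intersection lattice of the central plane arrangement in \<open>\<complex>\<^sup>3\<close>, ordered by reverse
  inclusion; the empty intersection is \<open>\<complex>\<^sup>3\<close> itself.
\<close>

definition intersection_lattice :: "poly3 \<Rightarrow> (complex ^ 3) set set"
  where "intersection_lattice h = {\<Inter>B |B. B \<subseteq> lines h}"

definition isomorphic_lattices :: "poly3 \<Rightarrow> poly3 \<Rightarrow> bool"
  where "isomorphic_lattices h h' \<longleftrightarrow>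
    (\<exists>\<phi>. bij_betw \<phi> (intersection_lattice h) (intersection_lattice h') \<and>
         (\<forall>U\<in>intersection_lattice h. \<forall>V\<in>intersection_lattice h.
            U \<supseteq> V \<longleftrightarrow> \<phi> U \<supseteq> \<phi> V))"

definition n_points :: "poly3 \<Rightarrow> nat \<Rightarrow> nat"
  where "n_points h k = card {P \<in> proj_plane. card {H \<in> lines h. P \<subseteq> H} = k}"

text \<open>
  The total Tjurina number of a line arrangement.  No point lies on more than \<open>card (lines h)\<close>
  lines, so the summation over \<open>k \<ge> 2\<close> stops there.
\<close>

definition tjurina :: "poly3 \<Rightarrow> nat"
  where "tjurina h = (\<Sum>k = 2..card (lines h). n_points h k * (k - 1)\<^sup>2)"

definition AR :: "poly3 \<Rightarrow> (poly3 \<times> poly3 \<times> poly3) set"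
  where "AR h = {(\<alpha>, \<beta>, \<gamma>). \<alpha> * diff_x h + \<beta> * diff_y h + \<gamma> * diff_z h = 0}"

definition AR_deg :: "poly3 \<Rightarrow> nat \<Rightarrow> (poly3 \<times> poly3 \<times> poly3) set"
  where "AR_deg h q =
    {(\<alpha>, \<beta>, \<gamma>) \<in> AR h. homogeneous q \<alpha> \<and> homogeneous q \<beta> \<and> homogeneous q \<gamma>}"

text \<open>
  For a product \<open>h\<close> of linear forms the minimum exists: the Koszul relation \<open>(h\<^sub>y, - h\<^sub>x, 0)\<close>
  and its analogues are homogeneous, and if \<open>h\<^sub>x = h\<^sub>y = h\<^sub>z = 0\<close> then \<open>AR h\<close> is all
  of \<open>S\<^sup>3\<close>.
\<close>

definition mdr :: "poly3 \<Rightarrow> nat"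
  where "mdr h = (LEAST q. AR_deg h q \<noteq> {(0, 0, 0)})"

definition maximal_tjurina_curve :: "poly3 \<Rightarrow> bool"
  where "maximal_tjurina_curve h \<longleftrightarrow>
    (let d = card (lines h); r = mdr h in
      d \<le> 2 * r \<and>
      int (tjurina h) =
        (int d - 1)\<^sup>2 - int r * (int d - int r - 1) - int ((2 * r + 2 - d) choose 2))"

end

theory Submission
  imports Defs
begin

text \<open>
  \<^bold>\<open>Combinatorics.\<close>  Listing the lines of \<open>\<A>\<^sub>f\<close> in a suitable order, three lines of
  \<open>\<A>\<^sub>f\<close> are concurrent iff the corresponding three lines of \<open>\<A>\<^sub>g\<close> are.  The vanishing of the
  3-by-3 determinants of the normal vectors determines both the intersection lattice
  (\<open>isomorphic_lattices_same_pattern\<close>) and the numbers of multiple points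
  (\<open>tjurina_normals\<close>), so the lattices are isomorphic, and both arrangements have total Tjurina
  number \<open>57\<close>.  For \<open>d = 10\<close> a maximal Tjurina curve with \<open>r = 6\<close> has \<open>\<tau> = 57\<close>, and one with
  \<open>r = 5\<close> has \<open>\<tau> = 60\<close>.  It remains to see that \<open>r = 6\<close> for \<open>g\<close> and \<open>r \<le> 5\<close> for \<open>f\<close>.

  \<^bold>\<open>Syzygies.\<close>  A Jacobian syzygy of a product \<open>h\<close> of linear forms is a derivation \<open>\<theta>\<close> of \<open>S\<close>
  with \<open>\<theta>(h) = 0\<close>; as the forms are non-associated primes, \<open>\<theta>(l)\<close> is then divisible by \<open>l\<close> for
  each factor \<open>l\<close> (\<open>syzygy_dvd\<close>).  Conversely such a logarithmic derivation becomes a syzygy after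
  subtracting a multiple of the Euler derivation (\<open>syzygy_of_logarithmic\<close>).  So one may work with
  logarithmic derivations modulo the Euler derivation, and normalise them by \<open>\<theta>(l) = 0\<close> for
  one line \<open>l\<close> of the arrangement.  If \<open>m\<close> lines pass through a point of \<open>l\<close>, then the
  values of the normalised \<open>\<theta>\<close> on the \<open>m - 1\<close> lines other than \<open>l\<close> are proportional, and hence
  divisible by the product of these \<open>m - 1\<close> forms.

  \<^bold>\<open>The curve g.\<close>  The line \<open>l = x - 2y - z\<close> contains the two quadruple points of
  \<open>\<A>\<^sub>g\<close>.  They give \<open>\<theta>(y + z) = Q\<^sub>1 s\<close> and \<open>\<theta>(y) = Q\<^sub>2 t\<close> with explicit cubics \<open>Q\<^sub>1, Q\<^sub>2\<close>.  In
  degree \<open>5\<close> the cofactors \<open>s\<close>, \<open>t\<close> are quadratic forms, and the three lines \<open>x\<close>, \<open>z\<close>, \<open>x + y\<close> that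
  miss both points impose linear conditions whose only solution is \<open>s = t = 0\<close>
  (\<open>quadratic_relations\<close>).  Hence there is no syzygy of degree \<open>5\<close> or less.  In degree \<open>6\<close> one can
  take \<open>t = 0\<close> and \<open>s = x z (x + y)\<close>.

  \<^bold>\<open>The curve f.\<close>  For the line \<open>2x - y - 2z\<close>, which contains the two quadruple points of
  \<open>\<A>\<^sub>f\<close>, the analogous linear system is degenerate: it has a solution, which is the syzygy of degree
  \<open>5\<close> written down in \<open>AR_deg_f\<close>.
\<close>

unbundle no fps_syntax

section \<open>The ring of polynomials in three variables\<close>

text \<open>Iterated, the next three lemmas lift homomorphisms and derivations from \<open>\<complex>[x]\<close> to the
  iterated polynomial ring \<open>S\<close>.\<close>

lemma map_poly_additive:
  assumes "\<phi> 0 = 0" "\<And>a b. \<phi> (a + b) = \<phi> a + \<phi> b"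
  shows "map_poly \<phi> (p + q) = map_poly \<phi> p + map_poly \<phi> q"
  by (intro poly_eqI) (simp add: assms coeff_map_poly)

lemma map_poly_multiplicative:
  fixes \<phi> :: "'a::comm_semiring_0 \<Rightarrow> 'b::comm_semiring_0"
  assumes "\<phi> 0 = 0" "\<And>a b. \<phi> (a + b) = \<phi> a + \<phi> b" "\<And>a b. \<phi> (a * b) = \<phi> a * \<phi> b"
  shows "map_poly \<phi> (p * q) = map_poly \<phi> p * map_poly \<phi> q"
  by (induction p) (simp_all add: assms map_poly_additive map_poly_pCons map_poly_smult)

lemma map_poly_derivation:
  fixes \<delta> :: "'a::comm_semiring_0 \<Rightarrow> 'a"
  assumes "\<delta> 0 = 0" "\<And>a b. \<delta> (a + b) = \<delta> a + \<delta> b"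
    "\<And>a b. \<delta> (a * b) = \<delta> a * b + a * \<delta> b"
  shows "map_poly \<delta> (p * q) = map_poly \<delta> p * q + p * map_poly \<delta> q"
proof (induction p)
  case (pCons a p)
  have "map_poly \<delta> (smult a q) = smult (\<delta> a) q + smult a (map_poly \<delta> q)"
    by (intro poly_eqI) (simp add: assms coeff_map_poly)
  then show ?case
    by (simp add: assms map_poly_additive map_poly_pCons pCons algebra_simps)
qed (simp add: assms)

lemma diff_x_add: "diff_x (p + q) = diff_x p + diff_x q"
  and diff_y_add: "diff_y (p + q) = diff_y p + diff_y q"
  and diff_z_add: "diff_z (p + q) = diff_z p + diff_z q"
  by (simp_all add: diff_x_def diff_y_def diff_z_def map_poly_additive pderiv_add)

lemma diff_x_mult: "diff_x (p * q) = diff_x p * q + p * diff_x q"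
  and diff_y_mult: "diff_y (p * q) = diff_y p * q + p * diff_y q"
  and diff_z_mult: "diff_z (p * q) = diff_z p * q + p * diff_z q"
  by (simp_all add: diff_x_def diff_y_def diff_z_def map_poly_derivation map_poly_additive
      pderiv_add pderiv_mult algebra_simps)

lemma eval3_simps [simp]:
  "eval3 0 v = 0" "eval3 1 v = 1"
  "eval3 (p + q) v = eval3 p v + eval3 q v" "eval3 (p - q) v = eval3 p v - eval3 q v"
  "eval3 (- p) v = - eval3 p v" "eval3 (p * q) v = eval3 p v * eval3 q v"
  "eval3 (p ^ n) v = eval3 p v ^ n" "eval3 (const3 c) v = c"
  "eval3 var_x v = v $ 1" "eval3 var_y v = v $ 2" "eval3 var_z v = v $ 3"
  by (simp_all add: eval3_def const3_def var_x_def var_y_def var_z_def)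

lemma eval3_numeral [simp]: "eval3 (numeral n) v = numeral n"
proof -
  have "numeral n = const3 (numeral n)"
    by (simp add: const3_def numeral_poly)
  then show ?thesis by (metis eval3_simps(8))
qed

lemma eval3_dvd: "l dvd p \<Longrightarrow> eval3 l v = 0 \<Longrightarrow> eval3 p v = 0"
  by (auto elim!: dvdE)

lemma poly3_eqI: "(\<And>i j k. coeff3 p i j k = coeff3 q i j k) \<Longrightarrow> p = q"
  by (simp add: poly_eq_iff coeff3_def)

lemma coeff3_add: "coeff3 (p + q) i j k = coeff3 p i j k + coeff3 q i j k"
  and coeff3_const3_mult: "coeff3 (const3 c * p) i j k = c * coeff3 p i j k"
  by (simp_all add: coeff3_def const3_def)

lemma coeff3_uminus: "coeff3 (- p) i j k = - coeff3 p i j k"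
  by (simp add: coeff3_def)

text \<open>
  The dilation \<open>h(x,y,z) \<mapsto> h(2x,2y,2z)\<close> is an injective ring endomorphism whose eigenspace for
  \<open>2\<^sup>q\<close> is the space of homogeneous polynomials of degree \<open>q\<close>.  Closure properties of
  homogeneity, in particular under division, become one-line computations with it.
\<close>

definition dilate :: "poly3 \<Rightarrow> poly3"
  where "dilate h = map_poly (\<lambda>p. map_poly (\<lambda>q. q \<circ>\<^sub>p [:0, 2:]) p \<circ>\<^sub>p [:0, 2:]) h \<circ>\<^sub>p [:0, 2:]"

lemma coeff_two_power_mult: "coeff (2 ^ k * p) i = 2 ^ k * coeff (p :: 'a::comm_ring_1 poly) i"
proof -
  have "2 ^ k * p = [:2 ^ k:] * p"
    by (simp add: poly_const_pow numeral_poly)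
  then show ?thesis by simp
qed

lemma coeff3_dilate: "coeff3 (dilate h) i j k = 2 ^ (i + j + k) * coeff3 h i j k"
  by (simp add: coeff3_def dilate_def coeff_pcompose_linear coeff_map_poly coeff_two_power_mult
      power_add mult_ac)

lemma dilate_mult: "dilate (p * q) = dilate p * dilate q"
proof -
  have 1: "map_poly (\<lambda>q. q \<circ>\<^sub>p [:0, 2:]) (a * b)
      = map_poly (\<lambda>q. q \<circ>\<^sub>p [:0, 2:]) a * map_poly (\<lambda>q. q \<circ>\<^sub>p [:0, 2:]) b"
    for a b :: "complex poly poly"
    by (intro map_poly_multiplicative) (simp_all add: pcompose_add pcompose_mult)
  have 2: "map_poly (\<lambda>q. q \<circ>\<^sub>p [:0, 2:]) (a + b)
      = map_poly (\<lambda>q. q \<circ>\<^sub>p [:0, 2:]) a + map_poly (\<lambda>q. q \<circ>\<^sub>p [:0, 2:]) b"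
    for a b :: "complex poly poly"
    by (intro map_poly_additive) (simp_all add: pcompose_add)
  show ?thesis
    unfolding dilate_def
    by (subst map_poly_multiplicative) (simp_all add: 1 2 pcompose_add pcompose_mult)
qed

lemma homogeneous_iff_dilate: "homogeneous q h \<longleftrightarrow> dilate h = 2 ^ q * h"
proof -
  have c: "coeff3 (2 ^ q * h) i j k = 2 ^ q * coeff3 h i j k" for i j k
    by (simp add: coeff3_def coeff_two_power_mult)
  have "dilate h = 2 ^ q * h \<longleftrightarrow> (\<forall>i j k. coeff3 (dilate h) i j k = coeff3 (2 ^ q * h) i j k)"
    by (metis poly3_eqI)
  also have "\<dots> \<longleftrightarrow> (\<forall>i j k. 2 ^ (i + j + k) * coeff3 h i j k = 2 ^ q * coeff3 h i j k)"
    by (simp add: c coeff3_dilate)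
  also have "\<dots> \<longleftrightarrow> homogeneous q h"
  proof -
    have "(2::complex) ^ m = 2 ^ n \<longleftrightarrow> m = n" for m n :: nat
      by (metis of_nat_eq_iff of_nat_numeral of_nat_power power_inject_exp one_less_numeral_iff
          semiring_norm(76))
    then have "2 ^ (i + j + k) * coeff3 h i j k = 2 ^ q * coeff3 h i j k
        \<longleftrightarrow> (coeff3 h i j k \<noteq> 0 \<longrightarrow> i + j + k = q)" for i j k
      by (subst mult_cancel_right) blast
    then show ?thesis unfolding homogeneous_def by simp
  qed
  finally show ?thesis ..
qed

lemma homogeneous_0: "homogeneous q 0"
  by (simp add: homogeneous_def coeff3_def)

lemma homogeneous_add: "homogeneous q a \<Longrightarrow> homogeneous q b \<Longrightarrow> homogeneous q (a + b)"
  unfolding homogeneous_def coeff3_def by (metis add.right_neutral coeff_add)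

lemma homogeneous_uminus: "homogeneous q a \<Longrightarrow> homogeneous q (- a)"
  by (auto simp: homogeneous_def coeff3_def)

lemma homogeneous_diff: "homogeneous q a \<Longrightarrow> homogeneous q b \<Longrightarrow> homogeneous q (a - b)"
  using homogeneous_add[of q a "- b"] homogeneous_uminus[of q b] by simp

lemma homogeneous_mult: "homogeneous m a \<Longrightarrow> homogeneous n b \<Longrightarrow> homogeneous (m + n) (a * b)"
  by (simp add: homogeneous_iff_dilate dilate_mult power_add mult_ac)

lemma homogeneous_const3: "homogeneous 0 (const3 c)"
  by (auto simp: homogeneous_def coeff3_def const3_def coeff_pCons split: nat.splits)

lemma homogeneous_var: "homogeneous 1 var_x" "homogeneous 1 var_y" "homogeneous 1 var_z"
  by (auto simp: homogeneous_def coeff3_def var_x_def var_y_def var_z_def coeff_pCons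
      split: nat.splits)

lemma const3_simps: "const3 (a + b) = const3 a + const3 b" "const3 (a * b) = const3 a * const3 b"
   "const3 (- a) = - const3 a"
   "const3 0 = 0" "const3 1 = 1"  "const3 (numeral n) = numeral n"
  by (simp_all add: const3_def numeral_poly one_pCons)

lemma const3_of_int: "const3 (of_int a) = of_int a"
  by (simp add: const3_def of_int_poly)

lemma homogeneous_numeral: "homogeneous 0 (numeral n)"
  by (metis const3_simps(6) homogeneous_const3)

text \<open>Cancellation in the domain \<open>S\<close>: \<open>\<sigma>(a) \<sigma>(b) = 2\<^sup>m\<^sup>+\<^sup>n a b\<close> and \<open>\<sigma>(a) = 2\<^sup>m a\<close> give
  \<open>\<sigma>(b) = 2\<^sup>n b\<close> for the dilation \<open>\<sigma>\<close>.\<close>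

lemma homogeneous_cofactor:
  assumes "homogeneous (m + n) (a * b)" "homogeneous m a" "a \<noteq> 0"
  shows "homogeneous n b"
proof -
  have "(2 ^ m * a) * dilate b = (2 ^ m * a) * (2 ^ n * b)"
    using assms(1,2) by (simp add: homogeneous_iff_dilate dilate_mult power_add mult_ac)
  then show ?thesis using assms(3) by (simp add: homogeneous_iff_dilate)
qed

lemma homogeneous_sum: "(\<And>i. i \<in> I \<Longrightarrow> homogeneous q (f i)) \<Longrightarrow> homogeneous q (sum f I)"
  by (induction I rule: infinite_finite_induct) (simp_all add: homogeneous_0 homogeneous_add)

lemma dilate_add: "dilate (p + q) = dilate p + dilate q"
  by (rule poly3_eqI) (simp add: coeff3_dilate coeff3_add algebra_simps)

lemma dilate_uminus: "dilate (- p) = - dilate p"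
  by (rule poly3_eqI) (simp add: coeff3_dilate coeff3_uminus)

lemma dilate_diff: "dilate (p - q) = dilate p - dilate q"
  using dilate_add[of p "- q"] by (simp add: dilate_uminus)

lemma dilate_var: "dilate var_x = 2 * var_x" "dilate var_y = 2 * var_y" "dilate var_z = 2 * var_z"
  using homogeneous_var by (simp_all add: homogeneous_iff_dilate)

lemma dilate_numeral: "dilate (numeral n) = numeral n"
  using homogeneous_numeral by (simp add: homogeneous_iff_dilate)

lemma dilate_power: "dilate (p ^ n) = dilate p ^ n"
  using homogeneous_const3[of 1]
  by (induction n) (simp_all add: dilate_mult homogeneous_iff_dilate const3_simps)

lemmas dilate_simps = dilate_add dilate_uminus dilate_diff dilate_mult dilate_power dilate_var
  dilate_numeral

lemma homogeneous_2_expand: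
  assumes "homogeneous 2 h"
  obtains a b c d e f where
    "\<And>v. eval3 h v = a * (v$1)\<^sup>2 + b * (v$1 * v$2) + c * (v$1 * v$3)
       + d * (v$2)\<^sup>2 + e * (v$2 * v$3) + f * (v$3)\<^sup>2"
    "h = const3 a * var_x\<^sup>2 + const3 b * (var_x * var_y) + const3 c * (var_x * var_z)
       + const3 d * var_y\<^sup>2 + const3 e * (var_y * var_z) + const3 f * var_z\<^sup>2"
proof -
  let ?h = "const3 (coeff3 h 2 0 0) * var_x\<^sup>2 + const3 (coeff3 h 1 1 0) * (var_x * var_y)
    + const3 (coeff3 h 1 0 1) * (var_x * var_z) + const3 (coeff3 h 0 2 0) * var_y\<^sup>2
    + const3 (coeff3 h 0 1 1) * (var_y * var_z) + const3 (coeff3 h 0 0 2) * var_z\<^sup>2"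
  have monomials:
    "coeff3 (var_x\<^sup>2) i j k = (if i = 2 \<and> j = 0 \<and> k = 0 then 1 else 0)"
    "coeff3 (var_x * var_y) i j k = (if i = 1 \<and> j = 1 \<and> k = 0 then 1 else 0)"
    "coeff3 (var_x * var_z) i j k = (if i = 1 \<and> j = 0 \<and> k = 1 then 1 else 0)"
    "coeff3 (var_y\<^sup>2) i j k = (if i = 0 \<and> j = 2 \<and> k = 0 then 1 else 0)"
    "coeff3 (var_y * var_z) i j k = (if i = 0 \<and> j = 1 \<and> k = 1 then 1 else 0)"
    "coeff3 (var_z\<^sup>2) i j k = (if i = 0 \<and> j = 0 \<and> k = 2 then 1 else 0)" for i j k
    by (auto simp: coeff3_def var_x_def var_y_def var_z_def coeff_pCons
          power2_eq_square numeral_2_eq_2 split: nat.splits)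
  have "h = ?h"
  proof (rule poly3_eqI)
    fix i j k
    show "coeff3 h i j k = coeff3 ?h i j k"
    proof (cases "i + j + k = 2")
      case True
      then have "i = 0 \<or> i = 1 \<or> i = 2" "j = 0 \<or> j = 1 \<or> j = 2" "k = 2 - i - j"
        by linarith+
      with True show ?thesis
        by (elim disjE) (simp_all add: coeff3_add coeff3_const3_mult monomials)
    next
      case False
      moreover from False have "\<not> (i = 2 \<and> j = 0 \<and> k = 0)" "\<not> (i = 1 \<and> j = 1 \<and> k = 0)"
        "\<not> (i = 1 \<and> j = 0 \<and> k = 1)" "\<not> (i = 0 \<and> j = 2 \<and> k = 0)"
        "\<not> (i = 0 \<and> j = 1 \<and> k = 1)" "\<not> (i = 0 \<and> j = 0 \<and> k = 2)"
        by auto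
      ultimately show ?thesis
        using assms unfolding coeff3_add coeff3_const3_mult monomials homogeneous_def
        by (simp only: if_False mult_zero_right add_0) blast
    qed
  qed
  moreover from this have "eval3 h v = eval3 ?h v" for v by simp
  ultimately show ?thesis using that by simp
qed

section \<open>Linear forms\<close>

definition lform :: "complex ^ 3 \<Rightarrow> poly3"
  where "lform u = const3 (u $ 1) * var_x + const3 (u $ 2) * var_y + const3 (u $ 3) * var_z"

definition pairing :: "complex ^ 3 \<Rightarrow> complex ^ 3 \<Rightarrow> complex"
  where "pairing u v = u $ 1 * v $ 1 + u $ 2 * v $ 2 + u $ 3 * v $ 3"

definition cross :: "complex ^ 3 \<Rightarrow> complex ^ 3 \<Rightarrow> complex ^ 3"
  where "cross u v = vector [u $ 2 * v $ 3 - u $ 3 * v $ 2, u $ 3 * v $ 1 - u $ 1 * v $ 3,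
    u $ 1 * v $ 2 - u $ 2 * v $ 1]"

definition plane :: "complex ^ 3 \<Rightarrow> (complex ^ 3) set"
  where "plane u = {v. pairing u v = 0}"

lemma eval3_lform [simp]: "eval3 (lform u) v = pairing u v"
  by (simp add: lform_def pairing_def)

lemma lform_pCons: "lform u = [:[:[:0, u $ 1:], [:u $ 2:]:], [:[:u $ 3:]:]:]"
  by (simp add: lform_def const3_def var_x_def var_y_def var_z_def)

lemma vec3_eq_iff: "u = v \<longleftrightarrow> u $ 1 = v $ 1 \<and> u $ 2 = v $ 2 \<and> u $ 3 = (v :: 'a ^ 3) $ 3"
  by (simp add: vec_eq_iff forall_3)

lemma lform_eq_0_iff [simp]: "lform u = 0 \<longleftrightarrow> u = 0"
  by (auto simp: lform_pCons vec3_eq_iff)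

lemma homogeneous_lform: "homogeneous 1 (lform u)"
proof -
  have "homogeneous (0 + 1) (const3 c * p)" if "homogeneous 1 p" for c p
    using that by (intro homogeneous_mult homogeneous_const3)
  then show ?thesis
    unfolding lform_def by (intro homogeneous_add) (simp_all only: add_0 homogeneous_var)
qed

lemma linear_form_iff: "linear_form l \<longleftrightarrow> (\<exists>u. u \<noteq> 0 \<and> l = lform u)"
proof
  assume l: "linear_form l"
  let ?u = "vector [coeff3 l 1 0 0, coeff3 l 0 1 0, coeff3 l 0 0 1] :: complex ^ 3"
  have "l = lform ?u"
  proof (rule poly3_eqI)
    fix i j k
    have "coeff3 l i j k = 0" if "i + j + k \<noteq> 1"
      using l that by (auto simp: linear_form_def homogeneous_def)
    then show "coeff3 l i j k = coeff3 (lform ?u) i j k"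
      by (auto simp: coeff3_def lform_pCons coeff_pCons vector_3 split: nat.splits)
  qed
  with l show "\<exists>u. u \<noteq> 0 \<and> l = lform u"
    by (metis lform_eq_0_iff linear_form_def)
qed (auto simp: linear_form_def homogeneous_lform simp del: One_nat_def)

text \<open>By the factor theorem, divisibility by \<open>bX + a\<close> with a unit \<open>b\<close> means vanishing at one point,
  and in a domain a product only vanishes there if one of its factors does.\<close>

lemma prime_elem_linear_unit_lead:
  fixes a b c :: "'a::idom"
  assumes "b * c = 1"
  shows "prime_elem [:a, b:]"
proof -
  have dvd: "[:a, b:] dvd p \<longleftrightarrow> poly p (- (c * a)) = 0" for p
  proof
    assume "[:a, b:] dvd p"
    moreover have "b * (c * a) = a" using assms by (metis mult.assoc mult_1)
    ultimately show "poly p (- (c * a)) = 0" by (auto elim!: dvdE simp: mult_ac)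
  next
    assume "poly p (- (c * a)) = 0"
    then obtain q where "p = [:c * a, 1:] * q" by (auto simp: poly_eq_0_iff_dvd elim: dvdE)
    then have "p = smult (b * c) ([:c * a, 1:] * q)" using assms by simp
    also have "\<dots> = smult b [:c * a, 1:] * smult c q"
      by (simp only: mult_smult_left mult_smult_right smult_smult mult.commute[of c b])
    also have "smult b [:c * a, 1:] = [:a, b:]" using assms by (simp flip: mult.assoc)
    finally show "[:a, b:] dvd p" by (rule dvdI)
  qed
  then show ?thesis using assms by (auto simp: prime_elem_def)
qed

lemma prime_elem_lform:
  assumes "u \<noteq> 0"
  shows "prime_elem (lform u)"
proof -
  consider "u $ 3 \<noteq> 0" | "u $ 3 = 0" "u $ 2 \<noteq> 0" | "u $ 3 = 0" "u $ 2 = 0" "u $ 1 \<noteq> 0"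
    using assms by (auto simp: vec3_eq_iff)
  then show ?thesis
  proof cases
    case 1
    then show ?thesis unfolding lform_pCons
      by (intro prime_elem_linear_unit_lead[where c = "[:[:inverse (u $ 3):]:]"])
        (simp add: one_pCons)
  next
    case 2
    then have "prime_elem [:[:0, u $ 1:], [:u $ 2:]:]"
      by (intro prime_elem_linear_unit_lead[where c = "[:inverse (u $ 2):]"]) (simp add: one_pCons)
    with 2 show ?thesis by (simp add: lform_pCons prime_elem_const_poly_iff)
  next
    case 3
    then show ?thesis
      by (simp add: lform_pCons prime_elem_const_poly_iff prime_elem_linear_field_poly)
  qed
qed

lemma prime_elem_dvd_prod:
  assumes "prime_elem p" "finite I" "p dvd prod f I"
  shows "\<exists>i\<in>I. p dvd f i"
  using assms(2,3)
proof (induction I)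
  case empty
  then show ?case using assms(1) by (simp add: prime_elem_def)
next
  case (insert i I)
  then show ?case using assms(1) by (auto simp: prime_elem_dvd_mult_iff)
qed

lemma plane_subset_iff:
  assumes "u \<noteq> 0"
  shows "plane u \<subseteq> plane w \<longleftrightarrow> cross u w = 0"
proof
  assume *: "plane u \<subseteq> plane w"
  have "vector [u $ 2, - u $ 1, 0] \<in> plane u" "vector [u $ 3, 0, - u $ 1] \<in> plane u"
    "vector [0, u $ 3, - u $ 2] \<in> plane u"
    by (simp_all add: plane_def pairing_def vector_3)
  with * have "vector [u $ 2, - u $ 1, 0] \<in> plane w" "vector [u $ 3, 0, - u $ 1] \<in> plane w"
    "vector [0, u $ 3, - u $ 2] \<in> plane w"
    by blast+
  then show "cross u w = 0"
    by (simp add: plane_def pairing_def vector_3 cross_def vec3_eq_iff algebra_simps)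
next
  assume "cross u w = 0"
  then have c: "u $ 2 * w $ 3 = u $ 3 * w $ 2" "u $ 3 * w $ 1 = u $ 1 * w $ 3"
    "u $ 1 * w $ 2 = u $ 2 * w $ 1"
    by (simp_all add: cross_def vec3_eq_iff vector_3)
  show "plane u \<subseteq> plane w"
  proof
    fix v assume "v \<in> plane u"
    then have v: "u $ 1 * v $ 1 + u $ 2 * v $ 2 + u $ 3 * v $ 3 = 0"
      by (simp add: plane_def pairing_def)
    have "u $ 1 * pairing w v = 0" "u $ 2 * pairing w v = 0" "u $ 3 * pairing w v = 0"
      using v c unfolding pairing_def by algebra+
    with assms have "pairing w v = 0" by (auto simp: vec3_eq_iff)
    then show "v \<in> plane w" by (simp add: plane_def)
  qed
qed

lemma cross_commute_0: "cross u w = 0 \<longleftrightarrow> cross w u = 0"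
  by (auto simp: cross_def vec3_eq_iff vector_3 algebra_simps)

lemma lform_dvd_lform: "lform u dvd lform w \<Longrightarrow> plane u \<subseteq> plane w"
  by (auto simp: plane_def dest: eval3_dvd)

lemma plane_inter:
  assumes "cross u w \<noteq> 0"
  shows "plane u \<inter> plane w = {c *s cross u w |c. True}"
proof (intro set_eqI iffI)
  fix v assume "v \<in> plane u \<inter> plane w"
  then have v: "u $ 1 * v $ 1 + u $ 2 * v $ 2 + u $ 3 * v $ 3 = 0"
    "w $ 1 * v $ 1 + w $ 2 * v $ 2 + w $ 3 * v $ 3 = 0"
    by (auto simp: plane_def pairing_def)
  let ?c = "cross u w"
  have par: "?c $ 1 * v $ 2 = ?c $ 2 * v $ 1" "?c $ 1 * v $ 3 = ?c $ 3 * v $ 1"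
    "?c $ 2 * v $ 3 = ?c $ 3 * v $ 2"
    using v unfolding cross_def vector_3 by algebra+
  from assms consider "?c $ 1 \<noteq> 0" | "?c $ 2 \<noteq> 0" | "?c $ 3 \<noteq> 0"
    by (metis vec3_eq_iff zero_index)
  then show "v \<in> {c *s cross u w |c. True}"
  proof cases
    case 1 with par have "v = (v $ 1 / ?c $ 1) *s ?c" by (simp add: vec3_eq_iff field_simps)
    then show ?thesis by blast
  next
    case 2 with par have "v = (v $ 2 / ?c $ 2) *s ?c" by (simp add: vec3_eq_iff field_simps)
    then show ?thesis by blast
  next
    case 3 with par have "v = (v $ 3 / ?c $ 3) *s ?c" by (simp add: vec3_eq_iff field_simps)
    then show ?thesis by blast
  qed
next
  fix v assume "v \<in> {c *s cross u w |c. True}"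
  then show "v \<in> plane u \<inter> plane w"
    by (auto simp: plane_def pairing_def cross_def vector_3 algebra_simps)
qed

section \<open>Arrangements and the incidence pattern of their lines\<close>

definition det3 :: "complex ^ 3 \<Rightarrow> complex ^ 3 \<Rightarrow> complex ^ 3 \<Rightarrow> complex"
  where "det3 u v w = pairing w (cross u v)"

locale arrangement =
  fixes u :: "nat \<Rightarrow> complex ^ 3" and d :: nat
  assumes nonzero: "i < d \<Longrightarrow> u i \<noteq> 0"
    and independent: "i < d \<Longrightarrow> j < d \<Longrightarrow> i \<noteq> j \<Longrightarrow> cross (u i) (u j) \<noteq> 0"
begin

definition "poly_of = (\<Prod>i<d. lform (u i))"

lemma plane_subset: "i < d \<Longrightarrow> j < d \<Longrightarrow> plane (u i) \<subseteq> plane (u j) \<longleftrightarrow> i = j"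
  using independent[of i j] plane_subset_iff[OF nonzero, of i "u j"] by auto

lemma inj_plane: "inj_on (\<lambda>i. plane (u i)) {..<d}"
  by (rule inj_onI) (metis plane_subset lessThan_iff order_refl)

lemma not_dvd: "i < d \<Longrightarrow> j < d \<Longrightarrow> i \<noteq> j \<Longrightarrow> \<not> lform (u i) dvd lform (u j)"
  using plane_subset lform_dvd_lform by blast

lemma inj_lform: "inj_on (\<lambda>i. lform (u i)) {..<d}"
  by (rule inj_onI) (metis not_dvd dvd_refl lessThan_iff)

lemma poly_of_nonzero: "poly_of \<noteq> 0"
  using nonzero by (simp add: poly_of_def)

lemma line_arrangement_poly_of: "line_arrangement d poly_of"
  unfolding line_arrangement_def
proof (intro exI conjI ballI impI)
  let ?L = "(\<lambda>i. lform (u i)) ` {..<d}"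
  show "finite ?L" by simp
  show "card ?L = d" using inj_lform by (simp add: card_image)
  show "poly_of = \<Prod> ?L" using inj_lform by (simp add: poly_of_def prod.reindex)
  show "linear_form l" if "l \<in> ?L" for l using that nonzero by (auto simp: linear_form_iff)
  show "\<not> proportional l m" if lm: "l \<in> ?L" "m \<in> ?L" "l \<noteq> m" for l m
  proof
    obtain i j where ij: "i < d" "j < d" "l = lform (u i)" "m = lform (u j)"
      using lm by auto
    assume "proportional l m"
    then have "l dvd m" by (auto simp: proportional_def)
    moreover have "i \<noteq> j" using lm ij by auto
    ultimately show False using ij not_dvd by blast
  qed
qed

lemma lines_poly_of: "lines poly_of = (\<lambda>i. plane (u i)) ` {..<d}"
proof (intro equalityI subsetI)
  fix H assume "H \<in> lines poly_of"
  then obtain w where w: "w \<noteq> 0" "lform w dvd poly_of" "H = plane w"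
    by (auto simp: lines_def linear_form_iff plane_def)
  then obtain i where i: "i < d" "lform w dvd lform (u i)"
    using prime_elem_dvd_prod[OF prime_elem_lform[OF w(1)], of "{..<d}"] by (auto simp: poly_of_def)
  then have "plane w \<subseteq> plane (u i)" by (rule_tac lform_dvd_lform)
  then have "H = plane (u i)"
    using w(1,3) nonzero[OF i(1)] plane_subset_iff cross_commute_0 by blast
  with i(1) show "H \<in> (\<lambda>i. plane (u i)) ` {..<d}" by blast
next
  fix H assume "H \<in> (\<lambda>i. plane (u i)) ` {..<d}"
  then obtain i where "i < d" "H = plane (u i)" by blast
  moreover from this have "lform (u i) dvd poly_of" by (auto simp: poly_of_def)
  ultimately show "H \<in> lines poly_of"
    using nonzero by (auto simp: lines_def linear_form_iff plane_def intro!: exI[of _ "lform (u i)"])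
qed

lemma card_lines: "card (lines poly_of) = d"
  using inj_plane by (simp add: lines_poly_of card_image)

subsection \<open>The intersection lattice\<close>

definition meet :: "nat set \<Rightarrow> (complex ^ 3) set"
  where "meet I = (\<Inter>i\<in>I. plane (u i))"

lemma intersection_lattice_poly_of: "intersection_lattice poly_of = meet ` Pow {..<d}"
proof -
  have "{B. B \<subseteq> lines poly_of} = (\<lambda>I. (\<lambda>i. plane (u i)) ` I) ` Pow {..<d}"
    unfolding lines_poly_of by (auto simp: subset_image_iff)
  then have "intersection_lattice poly_of = \<Inter> ` (\<lambda>I. (\<lambda>i. plane (u i)) ` I) ` Pow {..<d}"
    unfolding intersection_lattice_def setcompr_eq_image by (rule arg_cong)
  then show ?thesis by (simp add: image_image meet_def)
qed

text \<open>
  Membership in the closure of a set of planes only depends on which triples of normal vectors are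
  linearly dependent: two distinct planes meet in the line spanned by their cross product, and a
  third plane either contains this line or cuts it down to the origin.
\<close>

lemma meet_subset_plane_iff:
  assumes "I \<subseteq> {..<d}" "k < d"
  shows "meet I \<subseteq> plane (u k) \<longleftrightarrow> k \<in> I
    \<or> (\<exists>i\<in>I. \<exists>j\<in>I. i \<noteq> j \<and> det3 (u i) (u j) (u k) = 0)
    \<or> (\<exists>i\<in>I. \<exists>j\<in>I. \<exists>l\<in>I. i \<noteq> j \<and> det3 (u i) (u j) (u l) \<noteq> 0)"
proof -
  have "0 \<in> plane w" for w by (simp add: plane_def pairing_def)
  consider "I = {}" | i where "I = {i}" | i j where "i \<in> I" "j \<in> I" "i \<noteq> j"
    by blast
  then show ?thesis
  proof cases
    case 1
    have "plane (u k) \<noteq> UNIV"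
    proof
      assume "plane (u k) = UNIV"
      then have "axis i 1 \<in> plane (u k)" for i by simp
      from this[of 1] this[of 2] this[of 3] show False
        using nonzero[OF assms(2)] by (simp add: plane_def pairing_def axis_def vec3_eq_iff)
    qed
    with 1 show ?thesis by (auto simp: meet_def)
  next
    case 2
    with assms show ?thesis by (auto simp: meet_def plane_subset)
  next
    case 3
    let ?c = "cross (u i) (u j)"
    have c: "plane (u i) \<inter> plane (u j) = {t *s ?c |t. True}"
      using 3 assms by (intro plane_inter independent) auto
    have pair: "pairing w (t *s ?c) = t * pairing w ?c" for t w
      by (simp add: pairing_def algebra_simps)
    show ?thesis
    proof (cases "\<forall>l\<in>I. det3 (u i) (u j) (u l) = 0")
      case True
      have "meet I = {t *s ?c |t. True}"
      proof (intro equalityI subsetI)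
        fix v assume "v \<in> meet I"
        with 3 have "v \<in> plane (u i) \<inter> plane (u j)" by (auto simp: meet_def)
        then show "v \<in> {t *s ?c |t. True}" unfolding c .
      next
        fix v assume "v \<in> {t *s ?c |t. True}"
        then show "v \<in> meet I" using True by (auto simp: meet_def plane_def pair det3_def)
      qed
      have sub: "meet I \<subseteq> plane (u k) \<longleftrightarrow> det3 (u i) (u j) (u k) = 0"
      proof
        assume "meet I \<subseteq> plane (u k)"
        moreover have "1 *s ?c \<in> meet I" unfolding \<open>meet I = _\<close> by blast
        ultimately show "det3 (u i) (u j) (u k) = 0" by (auto simp: plane_def det3_def)
      next
        assume "det3 (u i) (u j) (u k) = 0"
        then show "meet I \<subseteq> plane (u k)"
          unfolding \<open>meet I = _\<close> by (auto simp: plane_def pair det3_def)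
      qed
      \<comment> \<open>For any other pair in \<open>I\<close> the situation is the same, since the meet is.\<close>
      have sub': "det3 (u a) (u b) (u l) = 0 \<longleftrightarrow> meet I \<subseteq> plane (u l)"
        if "a \<in> I" "b \<in> I" "a \<noteq> b" "l < d" for a b l
      proof -
        let ?e = "cross (u a) (u b)"
        have e: "plane (u a) \<inter> plane (u b) = {t *s ?e |t. True}"
          using that assms by (intro plane_inter independent) auto
        have "meet I \<subseteq> {t *s ?e |t. True}" using that unfolding e[symmetric] by (auto simp: meet_def)
        moreover have "1 *s ?c \<in> meet I" unfolding \<open>meet I = _\<close> by blast
        ultimately have "?c \<in> {t *s ?e |t. True}" by auto
        then obtain t where t: "?c = t *s ?e" by blast
        moreover have "?c \<noteq> 0" using 3 assms by (intro independent) auto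
        ultimately have "t \<noteq> 0" by auto
        have "pairing w ?c = t * pairing w ?e" for w
          unfolding t by (simp add: pairing_def algebra_simps)
        then show ?thesis using \<open>t \<noteq> 0\<close> unfolding \<open>meet I = _\<close>
          by (auto simp: plane_def pair det3_def intro: exI[of _ 1])
      qed
      have "meet I \<subseteq> plane (u l)" if "l \<in> I" for l using that by (auto simp: meet_def)
      then have "\<not> (\<exists>a\<in>I. \<exists>b\<in>I. \<exists>l\<in>I. a \<noteq> b \<and> det3 (u a) (u b) (u l) \<noteq> 0)"
        using sub' assms(1) by blast
      moreover have "(\<exists>a\<in>I. \<exists>b\<in>I. a \<noteq> b \<and> det3 (u a) (u b) (u k) = 0) \<longleftrightarrow> meet I \<subseteq> plane (u k)"
        using sub'[OF _ _ _ assms(2)] 3 by blast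
      moreover have "k \<in> I \<Longrightarrow> meet I \<subseteq> plane (u k)" by (auto simp: meet_def)
      ultimately show ?thesis by blast
    next
      case False
      then obtain l where l: "l \<in> I" "det3 (u i) (u j) (u l) \<noteq> 0" by blast
      have "meet I \<subseteq> {0}"
      proof
        fix v assume v: "v \<in> meet I"
        with 3 have "v \<in> plane (u i) \<inter> plane (u j)" by (auto simp: meet_def)
        then obtain t where t: "v = t *s ?c" unfolding c by blast
        moreover from v l have "pairing (u l) v = 0" by (auto simp: meet_def plane_def)
        ultimately show "v \<in> {0}" using l by (auto simp: pair det3_def)
      qed
      with \<open>\<And>w. 0 \<in> plane w\<close> have "meet I \<subseteq> plane (u k)" by blast
      with l 3 show ?thesis by blast
    qed
  qed
qed

lemma meet_subset_meet: "meet K \<subseteq> meet I \<longleftrightarrow> (\<forall>i\<in>I. meet K \<subseteq> plane (u i))"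
  by (auto simp: meet_def)

subsection \<open>Multiple points and the total Tjurina number\<close>

text \<open>A flat of rank two is recorded by the set of indices of the lines through its point.\<close>

definition flat :: "nat \<Rightarrow> nat \<Rightarrow> nat set"
  where "flat i j = {k. k < d \<and> det3 (u i) (u j) (u k) = 0}"

definition flats :: "nat set set"
  where "flats = {flat i j |i j. i < j \<and> j < d}"

lemma det3_repeated: "det3 v w v = 0" "det3 v w w = 0"
  by (simp_all add: det3_def pairing_def cross_def vector_3 algebra_simps)

lemma finite_flats: "finite flats"
proof -
  have "flats \<subseteq> Pow {..<d}" by (auto simp: flats_def flat_def)
  then show ?thesis by (rule finite_subset) simp
qed

definition through :: "(complex ^ 3) set \<Rightarrow> nat set"
  where "through P = {i. i < d \<and> P \<subseteq> plane (u i)}"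

lemma span_subset_plane: "vec.span {v} \<subseteq> plane w \<longleftrightarrow> pairing w v = 0"
proof
  assume "vec.span {v} \<subseteq> plane w"
  moreover have "v \<in> vec.span {v}" by (rule vec.span_base) simp
  ultimately show "pairing w v = 0" by (auto simp: plane_def)
next
  assume "pairing w v = 0"
  moreover have "pairing w (t *s v) = t * pairing w v" for t
    by (simp add: pairing_def algebra_simps)
  ultimately show "vec.span {v} \<subseteq> plane w" by (auto simp: plane_def vec.span_singleton)
qed

lemma card_lines_through: "card {H \<in> lines poly_of. P \<subseteq> H} = card (through P)"
proof -
  have "{H \<in> lines poly_of. P \<subseteq> H} = (\<lambda>i. plane (u i)) ` through P"
    by (auto simp: lines_poly_of through_def)
  moreover have "inj_on (\<lambda>i. plane (u i)) (through P)"
    by (rule inj_on_subset[OF inj_plane]) (auto simp: through_def)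
  ultimately show ?thesis by (simp add: card_image)
qed

lemma point_of_two_lines:
  assumes "P \<in> proj_plane" "i \<in> through P" "j \<in> through P" "i \<noteq> j"
  shows "P = plane (u i) \<inter> plane (u j)" "through P = flat i j"
proof -
  let ?c = "cross (u i) (u j)"
  have ij: "i < d" "j < d" using assms by (auto simp: through_def)
  obtain v where v: "v \<noteq> 0" "P = vec.span {v}" using assms(1) by (auto simp: proj_plane_def)
  have k: "plane (u i) \<inter> plane (u j) = {t *s ?c |t. True}"
    using ij assms(4) by (intro plane_inter independent) auto
  have "v \<in> plane (u i) \<inter> plane (u j)"
    using assms(2,3) v by (auto simp: through_def span_subset_plane) (simp_all add: plane_def)
  then obtain t where t: "v = t *s ?c" unfolding k by blast
  with v have "t \<noteq> 0" by auto
  have "P = {r *s ?c |r. True}"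
    unfolding v(2) t vec.span_singleton
  proof (intro equalityI subsetI)
    fix w assume "w \<in> {r *s ?c |r. True}"
    then obtain r where "w = r *s ?c" by blast
    then have "w = (r / t) *s (t *s ?c)" using \<open>t \<noteq> 0\<close> by simp
    then show "w \<in> range (\<lambda>k. k *s (t *s ?c))" by blast
  qed auto
  then show "P = plane (u i) \<inter> plane (u j)" by (simp add: k)
  have "pairing w v = t * pairing w ?c" for w
    by (simp add: t pairing_def algebra_simps)
  then show "through P = flat i j"
    using v \<open>t \<noteq> 0\<close> by (auto simp: through_def flat_def span_subset_plane det3_def)
qed

text \<open>A point on at least two lines is the intersection of any two of them, so it can be recovered from
  the indices of the lines through it.\<close>

lemma n_points_poly_of:
  assumes "2 \<le> k"
  shows "n_points poly_of k = card {F \<in> flats. card F = k}"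
proof -
  let ?S = "{P \<in> proj_plane. card (through P) = k}"
  have two: "\<exists>i j. i < j \<and> i \<in> through P \<and> j \<in> through P" if "P \<in> ?S" for P
  proof -
    obtain i j where "i \<in> through P" "j \<in> through P" "i \<noteq> j"
    proof (rule ccontr)
      assume "\<not> thesis"
      then have "\<forall>i\<in>through P. \<forall>j\<in>through P. i = j" using that by blast
      moreover have "finite (through P)" by (simp add: through_def)
      ultimately have "card (through P) \<le> 1" by (simp add: card_le_Suc0_iff_eq)
      with \<open>P \<in> ?S\<close> assms show False by simp
    qed
    then show ?thesis by (cases i j rule: linorder_cases) blast+
  qed
  have "bij_betw through ?S {F \<in> flats. card F = k}"
  proof (rule bij_betwI')
    fix P Q assume PQ: "P \<in> ?S" "Q \<in> ?S"
    show "through P = through Q \<longleftrightarrow> P = Q"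
    proof
      assume eq: "through P = through Q"
      obtain i j where "i < j" "i \<in> through P" "j \<in> through P" using two PQ by blast
      with PQ eq show "P = Q" using point_of_two_lines(1)[of _ i j] by blast
    qed simp
  next
    fix P assume P: "P \<in> ?S"
    then obtain i j where ij: "i < j" "i \<in> through P" "j \<in> through P" using two by blast
    then have "through P = flat i j" using P by (intro point_of_two_lines) auto
    then show "through P \<in> {F \<in> flats. card F = k}"
      using P ij by (auto simp: flats_def through_def)
  next
    fix F assume F: "F \<in> {F \<in> flats. card F = k}"
    then obtain i j where ij: "i < j" "j < d" "F = flat i j" by (auto simp: flats_def)
    let ?P = "vec.span {cross (u i) (u j)}"
    have "cross (u i) (u j) \<noteq> 0" using ij by (intro independent) auto
    then have "?P \<in> proj_plane" by (auto simp: proj_plane_def)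
    moreover have "through ?P = F"
      using ij by (auto simp: through_def span_subset_plane flat_def det3_def)
    ultimately show "\<exists>P\<in>?S. F = through P" using F by blast
  qed
  then show ?thesis by (simp add: n_points_def card_lines_through bij_betw_same_card)
qed

lemma card_flat:
  assumes "F \<in> flats"
  shows "card F \<in> {2..d}"
proof -
  obtain i j where ij: "i < j" "j < d" "F = flat i j" using assms by (auto simp: flats_def)
  have "{i, j} \<subseteq> F" using ij by (auto simp: flat_def det3_repeated)
  moreover have "F \<subseteq> {..<d}" using ij by (auto simp: flat_def)
  ultimately have "card {i, j} \<le> card F" "card F \<le> card {..<d}"
    by (meson card_mono finite_lessThan finite_subset)+
  with ij show ?thesis by auto
qed

lemma tjurina_poly_of: "tjurina poly_of = (\<Sum>F\<in>flats. (card F - 1)\<^sup>2)"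
proof -
  have "tjurina poly_of = (\<Sum>k=2..d. \<Sum>F\<in>{F \<in> flats. card F = k}. (card F - 1)\<^sup>2)"
    by (simp add: tjurina_def card_lines n_points_poly_of)
  also have "\<dots> = (\<Sum>F\<in>flats. (card F - 1)\<^sup>2)"
    using card_flat by (intro sum.group) (auto simp: finite_flats)
  finally show ?thesis .
qed

end

text \<open>
  The elements of either lattice are the meets of sets of planes, and the order between two meets is
  expressed by closures.  Hence sending the meet of the planes with indices in \<open>I\<close> to the
  meet with the same indices is a well-defined order isomorphism.
\<close>

lemma isomorphic_lattices_same_pattern:
  assumes "arrangement u d" "arrangement w d"
    and pattern: "\<And>i j k. i < d \<Longrightarrow> j < d \<Longrightarrow> k < d \<Longrightarrow>
      det3 (u i) (u j) (u k) = 0 \<longleftrightarrow> det3 (w i) (w j) (w k) = 0"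
  shows "isomorphic_lattices (arrangement.poly_of u d) (arrangement.poly_of w d)"
proof -
  interpret u: arrangement u d by fact
  interpret w: arrangement w d by fact
  have sub: "u.meet K \<subseteq> u.meet I \<longleftrightarrow> w.meet K \<subseteq> w.meet I" if "I \<subseteq> {..<d}" "K \<subseteq> {..<d}" for I K
  proof -
    have "u.meet K \<subseteq> plane (u k) \<longleftrightarrow> w.meet K \<subseteq> plane (w k)" if "k < d" for k
    proof -
      have "det3 (u i) (u j) (u l) = 0 \<longleftrightarrow> det3 (w i) (w j) (w l) = 0"
        if "i \<in> K" "j \<in> K" "l \<in> insert k K" for i j l
        using that \<open>K \<subseteq> {..<d}\<close> \<open>k < d\<close> by (intro pattern) auto
      then show ?thesis
        unfolding u.meet_subset_plane_iff[OF \<open>K \<subseteq> {..<d}\<close> that]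
          w.meet_subset_plane_iff[OF \<open>K \<subseteq> {..<d}\<close> that]
        by simp
    qed
    with that show ?thesis unfolding u.meet_subset_meet w.meet_subset_meet by blast
  qed
  \<comment> \<open>The largest index set with meet \<open>U\<close> serves as a canonical representative.\<close>
  define \<phi> where "\<phi> U = w.meet {i. i < d \<and> U \<subseteq> plane (u i)}" for U
  have \<phi>: "\<phi> (u.meet I) = w.meet I" if "I \<subseteq> {..<d}" for I
  proof -
    let ?J = "{i. i < d \<and> u.meet I \<subseteq> plane (u i)}"
    have "u.meet ?J = u.meet I"
      using that by (auto simp: u.meet_def)
    moreover have "?J \<subseteq> {..<d}" by blast
    ultimately have "w.meet ?J = w.meet I"
      using sub[of ?J I] sub[of I ?J] that by (metis order_antisym order_refl)
    then show ?thesis by (simp add: \<phi>_def)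
  qed
  show ?thesis
    unfolding isomorphic_lattices_def u.intersection_lattice_poly_of w.intersection_lattice_poly_of
  proof (intro exI[of _ \<phi>] conjI ballI)
    show "bij_betw \<phi> (u.meet ` Pow {..<d}) (w.meet ` Pow {..<d})"
    proof (rule bij_betw_imageI)
      show "inj_on \<phi> (u.meet ` Pow {..<d})"
      proof (rule inj_onI)
        fix U V assume UV: "U \<in> u.meet ` Pow {..<d}" "V \<in> u.meet ` Pow {..<d}" "\<phi> U = \<phi> V"
        then obtain I K where IK: "I \<subseteq> {..<d}" "K \<subseteq> {..<d}" "U = u.meet I" "V = u.meet K" by auto
        with UV(3) have "w.meet I = w.meet K" by (simp add: \<phi>)
        then show "U = V" using sub[OF IK(1,2)] sub[OF IK(2,1)] IK(3,4) by blast
      qed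
      show "\<phi> ` u.meet ` Pow {..<d} = w.meet ` Pow {..<d}"
        using \<phi> by (auto simp: image_image)
    qed
    fix U V assume "U \<in> u.meet ` Pow {..<d}" "V \<in> u.meet ` Pow {..<d}"
    then obtain I K where IK: "I \<subseteq> {..<d}" "K \<subseteq> {..<d}" "U = u.meet I" "V = u.meet K" by auto
    then show "U \<supseteq> V \<longleftrightarrow> \<phi> U \<supseteq> \<phi> V" by (simp add: \<phi> sub)
  qed
qed

section \<open>Jacobian syzygies as derivations\<close>

text \<open>The derivation \<open>\<alpha> \<partial>\<^sub>x + \<beta> \<partial>\<^sub>y + \<gamma> \<partial>\<^sub>z\<close> of \<open>S\<close>; the syzygies of \<open>h\<close> are the derivations that
  kill \<open>h\<close>.\<close>

definition vfield :: "poly3 \<Rightarrow> poly3 \<Rightarrow> poly3 \<Rightarrow> poly3 \<Rightarrow> poly3"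
  where "vfield \<alpha> \<beta> \<gamma> h = \<alpha> * diff_x h + \<beta> * diff_y h + \<gamma> * diff_z h"

lemma vfield_mult: "vfield \<alpha> \<beta> \<gamma> (p * q) = vfield \<alpha> \<beta> \<gamma> p * q + p * vfield \<alpha> \<beta> \<gamma> q"
  by (simp add: vfield_def diff_x_mult diff_y_mult diff_z_mult algebra_simps)

lemma vfield_lform:
  "vfield \<alpha> \<beta> \<gamma> (lform u) = const3 (u $ 1) * \<alpha> + const3 (u $ 2) * \<beta> + const3 (u $ 3) * \<gamma>"
proof -
  have "diff_x (lform u) = const3 (u $ 1)" "diff_y (lform u) = const3 (u $ 2)"
    "diff_z (lform u) = const3 (u $ 3)"
    by (simp_all add: diff_x_def diff_y_def diff_z_def lform_pCons const3_def map_poly_pCons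
        pderiv_pCons)
  then show ?thesis by (simp add: vfield_def mult.commute)
qed

lemma vfield_simps:
  "vfield \<alpha> \<beta> \<gamma> var_x = \<alpha>" "vfield \<alpha> \<beta> \<gamma> var_y = \<beta>" "vfield \<alpha> \<beta> \<gamma> var_z = \<gamma>"
  "vfield \<alpha> \<beta> \<gamma> (p + q) = vfield \<alpha> \<beta> \<gamma> p + vfield \<alpha> \<beta> \<gamma> q"
  "vfield \<alpha> \<beta> \<gamma> (p - q) = vfield \<alpha> \<beta> \<gamma> p - vfield \<alpha> \<beta> \<gamma> q"
  "vfield \<alpha> \<beta> \<gamma> (numeral n * p) = numeral n * vfield \<alpha> \<beta> \<gamma> p"
proof -
  show add: "vfield \<alpha> \<beta> \<gamma> (p + q) = vfield \<alpha> \<beta> \<gamma> p + vfield \<alpha> \<beta> \<gamma> q" for p q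
    by (simp add: vfield_def diff_x_add diff_y_add diff_z_add algebra_simps)
  show "vfield \<alpha> \<beta> \<gamma> (p - q) = vfield \<alpha> \<beta> \<gamma> p - vfield \<alpha> \<beta> \<gamma> q"
    using add[of "p - q" q] by simp
  have const: "vfield \<alpha> \<beta> \<gamma> (const3 c) = 0" for c
    by (simp add: vfield_def diff_x_def diff_y_def diff_z_def const3_def map_poly_pCons pderiv_pCons)
  show "vfield \<alpha> \<beta> \<gamma> (numeral n * p) = numeral n * vfield \<alpha> \<beta> \<gamma> p"
    using const[of "numeral n"] by (simp add: vfield_mult const3_simps)
  have "lform (vector [1, 0, 0]) = var_x" "lform (vector [0, 1, 0]) = var_y"
    "lform (vector [0, 0, 1]) = var_z"
    by (simp_all add: lform_def vector_3 const3_simps)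
  then show "vfield \<alpha> \<beta> \<gamma> var_x = \<alpha>" "vfield \<alpha> \<beta> \<gamma> var_y = \<beta>" "vfield \<alpha> \<beta> \<gamma> var_z = \<gamma>"
    using vfield_lform[of \<alpha> \<beta> \<gamma> "vector [1, 0, 0]"] vfield_lform[of \<alpha> \<beta> \<gamma> "vector [0, 1, 0]"]
      vfield_lform[of \<alpha> \<beta> \<gamma> "vector [0, 0, 1]"]
    by (simp_all add: vector_3 const3_simps)
qed

lemma vfield_prod:
  assumes "finite I" "\<And>i. i \<in> I \<Longrightarrow> vfield \<alpha> \<beta> \<gamma> (l i) = k i * l i"
  shows "vfield \<alpha> \<beta> \<gamma> (prod l I) = sum k I * prod l I"
  using assms
proof (induction I)
  case empty
  have "vfield \<alpha> \<beta> \<gamma> 1 = 0" using vfield_mult[of \<alpha> \<beta> \<gamma> 1 1] by simp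
  then show ?case by simp
qed (simp add: vfield_mult algebra_simps)

lemma AR_iff: "(\<alpha>, \<beta>, \<gamma>) \<in> AR h \<longleftrightarrow> vfield \<alpha> \<beta> \<gamma> h = 0"
  by (simp add: AR_def vfield_def)

lemma zero_in_AR_deg: "(0, 0, 0) \<in> AR_deg h q"
  by (simp add: AR_deg_def AR_def homogeneous_0)

text \<open>Multiplication by \<open>x\<close> embeds the syzygies of one degree into those of the next.\<close>

lemma AR_deg_Suc:
  assumes "AR_deg h (Suc q) = {(0, 0, 0)}"
  shows "AR_deg h q = {(0, 0, 0)}"
proof -
  have "(\<alpha>, \<beta>, \<gamma>) = (0, 0, 0)" if "(\<alpha>, \<beta>, \<gamma>) \<in> AR_deg h q" for \<alpha> \<beta> \<gamma>
  proof -
    have "var_x * \<alpha> * diff_x h + var_x * \<beta> * diff_y h + var_x * \<gamma> * diff_z h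
        = var_x * (\<alpha> * diff_x h + \<beta> * diff_y h + \<gamma> * diff_z h)"
      by (simp add: algebra_simps)
    then have "(var_x * \<alpha>, var_x * \<beta>, var_x * \<gamma>) \<in> AR_deg h (Suc q)"
      using that homogeneous_mult[OF homogeneous_var(1), of q] by (auto simp: AR_deg_def AR_def)
    moreover have "var_x \<noteq> 0" by (simp add: var_x_def)
    ultimately show ?thesis using assms by simp
  qed
  then show ?thesis using zero_in_AR_deg by fast
qed

lemma AR_deg_antimono:
  assumes "AR_deg h q = {(0, 0, 0)}" "p \<le> q"
  shows "AR_deg h p = {(0, 0, 0)}"
  using assms(2,1) by (induction rule: inc_induct) (simp_all add: AR_deg_Suc)

context arrangement
begin

text \<open>Distinct lines have non-associated prime equations.\<close>

lemma prod_lform_dvd: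
  assumes "I \<subseteq> {..<d}" "\<And>i. i \<in> I \<Longrightarrow> lform (u i) dvd h"
  shows "(\<Prod>i\<in>I. lform (u i)) dvd h"
proof -
  have "finite I" using assms(1) finite_subset by blast
  then show ?thesis using assms
  proof (induction I arbitrary: h)
    case (insert i I)
    have p: "prime_elem (lform (u j))" if "j < d" for j using that nonzero prime_elem_lform by blast
    obtain q where q: "h = lform (u i) * q" using insert.prems by blast
    have "lform (u j) dvd q" if "j \<in> I" for j
    proof -
      have j: "j < d" "i < d" "j \<noteq> i" using insert that by auto
      have "lform (u j) dvd lform (u i) * q" using insert.prems that q by blast
      then show ?thesis using prime_elem_dvd_multD[OF p[OF j(1)]] not_dvd[OF j] by blast
    qed
    then have "(\<Prod>j\<in>I. lform (u j)) dvd q" using insert by blast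
    then show ?case using insert.hyps q by (simp add: mult_dvd_mono)
  qed simp
qed

text \<open>
  Write \<open>h = l R\<close>.  Then \<open>0 = \<theta>(h) = \<theta>(l) R + l \<theta>(R)\<close>, and the prime \<open>l\<close> does not divide \<open>R\<close>.
\<close>

lemma syzygy_dvd:
  assumes "(\<alpha>, \<beta>, \<gamma>) \<in> AR poly_of" "i < d"
  shows "lform (u i) dvd vfield \<alpha> \<beta> \<gamma> (lform (u i))"
proof -
  let ?R = "\<Prod>j\<in>{..<d} - {i}. lform (u j)" and ?l = "lform (u i)"
  have p: "prime_elem ?l" using assms(2) nonzero prime_elem_lform by blast
  have "poly_of = ?l * ?R" using assms(2) by (simp add: poly_of_def prod.remove)
  then have "vfield \<alpha> \<beta> \<gamma> ?l * ?R = ?l * (- vfield \<alpha> \<beta> \<gamma> ?R)"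
    using assms(1) by (simp add: AR_iff vfield_mult add_eq_0_iff)
  then have "?l dvd vfield \<alpha> \<beta> \<gamma> ?l * ?R" by simp
  moreover have "\<not> ?l dvd ?R"
    using prime_elem_dvd_prod[OF p, of "{..<d} - {i}"] not_dvd[of i] assms(2) by blast
  ultimately show ?thesis using prime_elem_dvd_multD[OF p] by blast
qed

lemma vfield_euler: "vfield (a * var_x) (a * var_y) (a * var_z) poly_of = of_nat d * a * poly_of"
proof -
  have "vfield (a * var_x) (a * var_y) (a * var_z) (lform w) = a * lform w" for w
    by (simp add: vfield_lform) (simp add: lform_def algebra_simps)
  then show ?thesis
    unfolding poly_of_def by (subst vfield_prod[where k = "\<lambda>_. a"]) simp_all
qed

text \<open>
  A logarithmic derivation satisfies \<open>\<theta>(h) = K h\<close> for a form \<open>K\<close>, and the Euler derivation \<open>E\<close>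
  satisfies \<open>E(h) = d h\<close>, so that \<open>d \<theta> - K E\<close> is a syzygy.  If it vanished, then evaluating it on a
  form \<open>l\<close> with \<open>\<theta>(l) = 0\<close> would give \<open>K l = 0\<close>, hence \<open>K = 0\<close> and \<open>\<theta> = 0\<close>.
\<close>

lemma syzygy_of_logarithmic:
  assumes hom: "homogeneous (Suc q) \<alpha>" "homogeneous (Suc q) \<beta>" "homogeneous (Suc q) \<gamma>"
    and log: "\<And>i. i < d \<Longrightarrow> lform (u i) dvd vfield \<alpha> \<beta> \<gamma> (lform (u i))"
    and kills: "k < d" "vfield \<alpha> \<beta> \<gamma> (lform (u k)) = 0"
    and nz: "(\<alpha>, \<beta>, \<gamma>) \<noteq> (0, 0, 0)"
  shows "AR_deg poly_of (Suc q) \<noteq> {(0, 0, 0)}"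
proof -
  obtain c where c: "vfield \<alpha> \<beta> \<gamma> (lform (u i)) = c i * lform (u i)" if "i < d" for i
    using log unfolding dvd_def by (metis mult.commute)
  define K where "K = (\<Sum>i<d. c i)"
  have "homogeneous q (c i)" if "i < d" for i
  proof (rule homogeneous_cofactor)
    have "homogeneous (0 + Suc q) (const3 a * p)" if "homogeneous (Suc q) p" for a p
      using that by (intro homogeneous_mult homogeneous_const3)
    then have "homogeneous (Suc q) (vfield \<alpha> \<beta> \<gamma> (lform (u i)))"
      unfolding vfield_lform using hom by (intro homogeneous_add) simp_all
    then show "homogeneous (1 + q) (lform (u i) * c i)" using c that by (simp add: mult.commute)
  qed (use that nonzero homogeneous_lform in auto)
  then have K: "homogeneous q K"
    unfolding K_def by (intro homogeneous_sum) simp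
  let ?D = "of_nat d :: poly3"
  let ?a = "?D * \<alpha> - K * var_x" and ?b = "?D * \<beta> - K * var_y" and ?c = "?D * \<gamma> - K * var_z"
  have split: "vfield ?a ?b ?c h = ?D * vfield \<alpha> \<beta> \<gamma> h - vfield (K * var_x) (K * var_y) (K * var_z) h"
    for h by (simp add: vfield_def algebra_simps)
  have "vfield \<alpha> \<beta> \<gamma> poly_of = K * poly_of"
    unfolding poly_of_def K_def by (rule vfield_prod) (simp_all add: c)
  then have "(?a, ?b, ?c) \<in> AR poly_of"
    by (simp add: AR_iff split vfield_euler)
  moreover have "homogeneous (Suc q) (?D * p - K * v)" if "homogeneous (Suc q) p" "homogeneous 1 v" for p v
  proof -
    have "homogeneous (0 + Suc q) (?D * p)"
      by (intro homogeneous_mult that) (metis const3_of_int homogeneous_const3 of_int_of_nat_eq)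
    moreover have "homogeneous (q + 1) (K * v)" by (intro homogeneous_mult that K)
    ultimately show ?thesis by (intro homogeneous_diff) simp_all
  qed
  ultimately have "(?a, ?b, ?c) \<in> AR_deg poly_of (Suc q)"
    using hom homogeneous_var by (simp add: AR_deg_def del: One_nat_def)
  moreover have "(?a, ?b, ?c) \<noteq> (0, 0, 0)"
  proof
    assume 0: "(?a, ?b, ?c) = (0, 0, 0)"
    have "?D * vfield \<alpha> \<beta> \<gamma> (lform (u k)) - K * lform (u k)
        = const3 (u k $ 1) * ?a + const3 (u k $ 2) * ?b + const3 (u k $ 3) * ?c"
      by (simp add: vfield_lform) (simp add: lform_def algebra_simps)
    with 0 kills have "K * lform (u k) = 0" by simp
    then have "K = 0" using nonzero kills by simp
    with 0 have "?D * \<alpha> = 0" "?D * \<beta> = 0" "?D * \<gamma> = 0" by simp_all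
    with kills(1) nz show False by simp
  qed
  moreover have "A \<noteq> {z}" if "t \<in> A" "t \<noteq> z" for t z :: "poly3 \<times> poly3 \<times> poly3" and A
    using that by blast
  ultimately show ?thesis by metis
qed

end

section \<open>Arrangements with integral normal vectors\<close>

type_synonym ivec = "int \<times> int \<times> int"

fun icross :: "ivec \<Rightarrow> ivec \<Rightarrow> ivec"
  where "icross (a, b, c) (a', b', c') = (b * c' - c * b', c * a' - a * c', a * b' - b * a')"

fun idot :: "ivec \<Rightarrow> ivec \<Rightarrow> int"
  where "idot (a, b, c) (a', b', c') = a * a' + b * b' + c * c'"

definition normals :: "ivec list \<Rightarrow> nat \<Rightarrow> complex ^ 3"
  where "normals N i = (case N ! i of (a, b, c) \<Rightarrow> vector [of_int a, of_int b, of_int c])"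

text \<open>Increasing lists of indices represent flats in executable form.\<close>

definition flat_list :: "ivec list \<Rightarrow> nat \<Rightarrow> nat \<Rightarrow> nat list"
  where "flat_list N i j = filter (\<lambda>k. idot (N ! k) (icross (N ! i) (N ! j)) = 0) [0..<length N]"

definition flat_lists :: "ivec list \<Rightarrow> nat list list"
  where "flat_lists N = remdups (concat (map (\<lambda>j. map (\<lambda>i. flat_list N i j) [0..<j]) [0..<length N]))"

lemma det3_normals:
  "det3 (normals N i) (normals N j) (normals N k) = of_int (idot (N ! k) (icross (N ! i) (N ! j)))"
  by (cases "N ! i"; cases "N ! j"; cases "N ! k")
    (simp add: normals_def det3_def pairing_def cross_def vector_3)

lemma lform_normals:
  "lform (normals N i) = (case N ! i of (a, b, c) \<Rightarrow> of_int a * var_x + of_int b * var_y + of_int c * var_z)"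
  by (cases "N ! i") (simp add: normals_def lform_def vector_3 const3_of_int)

lemma arrangement_normals:
  assumes "\<forall>j<length N. N ! j \<noteq> (0, 0, 0) \<and> (\<forall>i<j. icross (N ! i) (N ! j) \<noteq> (0, 0, 0))"
  shows "arrangement (normals N) (length N)"
proof
  show "normals N i \<noteq> 0" if "i < length N" for i
    using assms that by (cases "N ! i") (auto simp: normals_def vec3_eq_iff vector_3)
  have less: "cross (normals N i) (normals N j) \<noteq> 0" if "i < j" "j < length N" for i j
  proof
    assume 0: "cross (normals N i) (normals N j) = 0"
    obtain a b c a' b' c' where N: "N ! i = (a, b, c)" "N ! j = (a', b', c')"
      by (metis prod_cases3)
    with 0 have "complex_of_int (b * c' - c * b') = 0" "complex_of_int (c * a' - a * c') = 0"
      "complex_of_int (a * b' - b * a') = 0"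
      by (simp_all add: cross_def normals_def vec3_eq_iff vector_3)
    then have "icross (N ! i) (N ! j) = (0, 0, 0)" unfolding N of_int_eq_0_iff by simp
    with assms that show False by blast
  qed
  show "cross (normals N i) (normals N j) \<noteq> 0" if "i < length N" "j < length N" "i \<noteq> j" for i j
    using less[of i j] less[of j i] that cross_commute_0 by (metis linorder_neqE_nat)
qed

lemma tjurina_normals:
  assumes "arrangement (normals N) (length N)"
  shows "tjurina (arrangement.poly_of (normals N) (length N))
    = (\<Sum>L\<leftarrow>flat_lists N. (length L - 1)\<^sup>2)"
proof -
  interpret arrangement "normals N" "length N" by fact
  have flat: "flat i j = set (flat_list N i j)" for i j
    by (auto simp: flat_def flat_list_def det3_normals)
  have flats: "flats = (\<Union>j\<in>{..<length N}. (\<lambda>i. flat i j) ` {..<j})"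
  proof (intro equalityI subsetI)
    fix F assume "F \<in> flats"
    then obtain i j where "i < j" "j < length N" "F = flat i j" by (auto simp: flats_def)
    then show "F \<in> (\<Union>j\<in>{..<length N}. (\<lambda>i. flat i j) ` {..<j})"
      by (intro UN_I[of j] image_eqI[of _ _ i]) auto
  qed (auto simp: flats_def)
  have "set (flat_lists N) = (\<Union>j\<in>{..<length N}. (\<lambda>i. flat_list N i j) ` {..<j})"
    by (simp add: flat_lists_def lessThan_atLeast0)
  then have "flats = set ` set (flat_lists N)"
    by (simp add: flats flat image_UN image_image)
  moreover have ordered: "sorted L \<and> distinct L" if "L \<in> set (flat_lists N)" for L
    using that by (auto simp: flat_lists_def flat_list_def sorted_wrt_filter)
  then have "inj_on set (set (flat_lists N))"
    by (meson inj_onI sorted_distinct_set_unique)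
  ultimately have "tjurina poly_of = (\<Sum>L\<in>set (flat_lists N). (card (set L) - 1)\<^sup>2)"
    by (simp add: tjurina_poly_of sum.reindex)
  also have "\<dots> = (\<Sum>L\<in>set (flat_lists N). (length L - 1)\<^sup>2)"
    using ordered by (intro sum.cong) (simp_all add: distinct_card)
  also have "\<dots> = (\<Sum>L\<leftarrow>flat_lists N. (length L - 1)\<^sup>2)"
    by (rule sum_list_distinct_conv_sum_set[symmetric]) (simp add: flat_lists_def)
  finally show ?thesis .
qed

section \<open>The two arrangements of ten lines\<close>

text \<open>The factors of \<open>f\<close> are permuted so that equal positions in the two lists correspond under the
  isomorphism of the lattices.\<close>

definition f_normals :: "ivec list"
  where "f_normals = [(0, 1, -1), (1, -1, 1), (0, 1, 2), (0, 2, 1), (1, -2, -1), (1, -1, -2),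
    (1, 1, -1), (1, 1, 2), (2, -1, -2), (1, -3, -1)]"

definition g_normals :: "ivec list"
  where "g_normals = [(1, 0, 0), (0, 0, 1), (1, -1, 0), (1, 1, 0), (1, -1, -1), (0, 1, 1),
    (1, 0, -1), (1, 1, 2), (1, -2, -1), (1, -3, -1)]"

lemma length_normals: "length f_normals = 10" "length g_normals = 10"
  by (simp_all add: f_normals_def g_normals_def)

lemma arrangement_f: "arrangement (normals f_normals) 10"
proof -
  have "\<forall>j\<in>set [0..<10]. f_normals ! j \<noteq> (0, 0, 0)
      \<and> (\<forall>i\<in>set [0..<j]. icross (f_normals ! i) (f_normals ! j) \<noteq> (0, 0, 0))"
    unfolding f_normals_def by code_simp
  then show ?thesis using arrangement_normals[of f_normals] by (simp add: length_normals)
qed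

lemma arrangement_g: "arrangement (normals g_normals) 10"
proof -
  have "\<forall>j\<in>set [0..<10]. g_normals ! j \<noteq> (0, 0, 0)
      \<and> (\<forall>i\<in>set [0..<j]. icross (g_normals ! i) (g_normals ! j) \<noteq> (0, 0, 0))"
    unfolding g_normals_def by code_simp
  then show ?thesis using arrangement_normals[of g_normals] by (simp add: length_normals)
qed

interpretation f: arrangement "normals f_normals" 10 by (rule arrangement_f)
interpretation g: arrangement "normals g_normals" 10 by (rule arrangement_g)

lemma isomorphic_f_g: "isomorphic_lattices f.poly_of g.poly_of"
proof (rule isomorphic_lattices_same_pattern[OF arrangement_f arrangement_g])
  have "\<forall>i\<in>set [0..<10]. \<forall>j\<in>set [0..<10]. \<forall>k\<in>set [0..<10].
      idot (f_normals ! k) (icross (f_normals ! i) (f_normals ! j)) = 0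
      \<longleftrightarrow> idot (g_normals ! k) (icross (g_normals ! i) (g_normals ! j)) = 0"
    unfolding f_normals_def g_normals_def by code_simp
  then show "det3 (normals f_normals i) (normals f_normals j) (normals f_normals k) = 0
      \<longleftrightarrow> det3 (normals g_normals i) (normals g_normals j) (normals g_normals k) = 0"
    if "i < 10" "j < 10" "k < 10" for i j k
    using that by (simp add: det3_normals)
qed

lemma tjurina_f: "tjurina f.poly_of = 57"
proof -
  have "(\<Sum>L\<leftarrow>flat_lists f_normals. (length L - 1)\<^sup>2) = 57"
    unfolding f_normals_def by code_simp
  then show ?thesis using tjurina_normals[of f_normals] arrangement_f by (simp add: length_normals)
qed

lemma tjurina_g: "tjurina g.poly_of = 57"
proof -
  have "(\<Sum>L\<leftarrow>flat_lists g_normals. (length L - 1)\<^sup>2) = 57"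
    unfolding g_normals_def by code_simp
  then show ?thesis using tjurina_normals[of g_normals] arrangement_g by (simp add: length_normals)
qed

lemma lform_f:
  "lform (normals f_normals 0) = var_y - var_z"
  "lform (normals f_normals 1) = var_x - var_y + var_z"
  "lform (normals f_normals 2) = var_y + 2 * var_z"
  "lform (normals f_normals 3) = 2 * var_y + var_z"
  "lform (normals f_normals 4) = var_x - 2 * var_y - var_z"
  "lform (normals f_normals 5) = var_x - var_y - 2 * var_z"
  "lform (normals f_normals 6) = var_x + var_y - var_z"
  "lform (normals f_normals 7) = var_x + var_y + 2 * var_z"
  "lform (normals f_normals 8) = 2 * var_x - var_y - 2 * var_z"
  "lform (normals f_normals 9) = var_x - 3 * var_y - var_z"
  by (simp_all add: lform_normals f_normals_def)

lemma lform_g: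
  "lform (normals g_normals 0) = var_x"
  "lform (normals g_normals 1) = var_z"
  "lform (normals g_normals 2) = var_x - var_y"
  "lform (normals g_normals 3) = var_x + var_y"
  "lform (normals g_normals 4) = var_x - var_y - var_z"
  "lform (normals g_normals 5) = var_y + var_z"
  "lform (normals g_normals 6) = var_x - var_z"
  "lform (normals g_normals 7) = var_x + var_y + 2 * var_z"
  "lform (normals g_normals 8) = var_x - 2 * var_y - var_z"
  "lform (normals g_normals 9) = var_x - 3 * var_y - var_z"
  by (simp_all add: lform_normals g_normals_def)

lemma all_less_10: "(\<forall>i<10. P i) \<longleftrightarrow> P 0 \<and> P 1 \<and> P 2 \<and> P 3 \<and> P 4 \<and> P 5 \<and> P 6 \<and> P 7 \<and> P 8
    \<and> P (9::nat)"
  by (simp add: eval_nat_numeral less_Suc_eq all_conj_distrib imp_conjL conj_ac)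

lemma prod_less_10: "(\<Prod>i<10. l i) = l 0 * l 1 * l 2 * l 3 * l 4 * l 5 * l 6 * l 7 * l 8
    * (l (9::nat) :: 'a::comm_monoid_mult)"
  by (simp add: eval_nat_numeral)

lemma f_poly_of:
  "f.poly_of = (var_y - var_z) * (var_y + 2 * var_z) * (2 * var_y + var_z)
    * (var_x - 2 * var_y - var_z) * (var_x - var_y - 2 * var_z) * (var_x - var_y + var_z)
    * (var_x + var_y - var_z) * (var_x + var_y + 2 * var_z) * (2 * var_x - var_y - 2 * var_z)
    * (var_x - 3 * var_y - var_z)"
  unfolding f.poly_of_def prod_less_10 lform_f by (simp only: mult_ac)

lemma g_poly_of:
  "g.poly_of = var_x * var_z * (var_x - var_y) * (var_x + var_y) * (var_x - var_y - var_z)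
    * (var_y + var_z) * (var_x - var_z) * (var_x + var_y + 2 * var_z)
    * (var_x - 2 * var_y - var_z) * (var_x - 3 * var_y - var_z)"
  unfolding g.poly_of_def prod_less_10 lform_g by (simp only: mult_ac)

text \<open>
  The derivation \<open>\<theta>\<close> below kills \<open>2x - y - 2z\<close>.  Its values on the lines through the two quadruple
  points are multiples of \<open>m W\<close> and of \<open>m R\<close>, respectively, so that only the lines
  \<open>y - z\<close>, \<open>2y + z\<close> and \<open>x - y + z\<close> require a computation.  The quadratic factor of \<open>R\<close> was found by
  solving the resulting linear system.
\<close>

lemma AR_deg_f: "AR_deg f.poly_of 5 \<noteq> {(0, 0, 0)}"
proof -
  define x y z where xyz: "x = var_x" "y = var_y" "z = var_z"
  define W where "W = (y + 2 * z) * (x - y - 2 * z) * (x + y + 2 * z) * x"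
  define R where "R = (x - 2 * y - z) * (x + y - z) * (x * y - y ^ 2 + 3 * y * z + z ^ 2)"
  define m where "m = x - 3 * y - z"
  define \<alpha> \<beta> \<gamma> where abc: "\<alpha> = m * W" "\<beta> = 2 * m * R" "\<gamma> = m * (W - R)"
  have "lform (normals f_normals i) dvd vfield \<alpha> \<beta> \<gamma> (lform (normals f_normals i))"
    if "i < 10" for i
  proof -
    have "3 * R - W = (y - z) * (2 * x^3 - 6 * x^2 * y - 3 * x^2 * z - 2 * x * y^2 + 4 * x * y * z
        - 2 * x * z^2 + 6 * y^3 - 15 * y^2 * z - 15 * y * z^2 - 3 * z^3)"
      "3 * R + W = (2 * y + z) * (2 * x^3 - 3 * x^2 * y + 3 * x^2 * z - 2 * x * y^2 - 2 * x * y * z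
        - 14 * x * z^2 + 3 * y^3 - 12 * y^2 * z + 6 * y * z^2 + 3 * z^3)"
      "2 * W - 3 * R = (x - y + z) * (4 * x^2 * z - x^2 * y + 5 * x * y^2 + 2 * x * y * z
        - 7 * x * z^2 + 6 * y^3 - 15 * y^2 * z - 15 * y * z^2 - 3 * z^3)"
      unfolding W_def R_def by algebra+
    then have "y - z dvd 3 * R - W" "2 * y + z dvd 3 * R + W" "x - y + z dvd 2 * W - 3 * R"
      by (metis dvd_triv_left)+
    moreover have "y + 2 * z dvd W" "x - y - 2 * z dvd W" "x + y + 2 * z dvd W"
      "x - 2 * y - z dvd R" "x + y - z dvd R"
      by (simp_all add: W_def R_def)
    moreover have "\<beta> - \<gamma> = m * (3 * R - W)" "\<alpha> - \<beta> + \<gamma> = m * (2 * W - 3 * R)"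
      "\<beta> + 2 * \<gamma> = 2 * m * W" "2 * \<beta> + \<gamma> = m * (3 * R + W)" "\<alpha> - 2 * \<beta> - \<gamma> = - 3 * m * R"
      "\<alpha> - \<beta> - 2 * \<gamma> = - m * W" "\<alpha> + \<beta> - \<gamma> = 3 * m * R" "\<alpha> + \<beta> + 2 * \<gamma> = 3 * m * W"
      "2 * \<alpha> - \<beta> - 2 * \<gamma> = 0" "\<alpha> - 3 * \<beta> - \<gamma> = m * (- 5 * R)"
      unfolding abc by algebra+
    ultimately have "\<forall>i<10. lform (normals f_normals i) dvd vfield \<alpha> \<beta> \<gamma> (lform (normals f_normals i))"
      unfolding all_less_10 lform_f vfield_simps
      by (simp flip: xyz) (simp add: m_def)
    with that show ?thesis by blast
  qed
  moreover have "homogeneous 5 \<alpha>" "homogeneous 5 \<beta>" "homogeneous 5 \<gamma>"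
    unfolding homogeneous_iff_dilate abc W_def R_def m_def xyz dilate_simps by algebra+
  moreover have "vfield \<alpha> \<beta> \<gamma> (lform (normals f_normals 8)) = 0"
    by (simp add: lform_f vfield_simps abc) (simp add: algebra_simps)
  moreover have "\<alpha> \<noteq> 0"
  proof
    assume "\<alpha> = 0"
    then have "eval3 \<alpha> (vector [1, 1, 1]) = 0" by simp
    then show False by (simp add: abc W_def m_def xyz vector_3)
  qed
  ultimately show ?thesis using f.syzygy_of_logarithmic[of 4 \<alpha> \<beta> \<gamma> 8] by simp
qed

text \<open>
  The derivation \<open>w (\<partial>\<^sub>x + \<partial>\<^sub>z)\<close> kills the four lines through the quadruple point \<open>(1:0:1)\<close>, and
  \<open>w\<close> is the product of the other six forms.
\<close>

lemma AR_deg_g_6: "AR_deg g.poly_of 6 \<noteq> {(0, 0, 0)}"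
proof -
  define x y z where xyz: "x = var_x" "y = var_y" "z = var_z"
  define w where "w = x * z * (x - y) * (x + y) * (y + z) * (x + y + 2 * z)"
  have "\<forall>i<10. lform (normals g_normals i) dvd vfield w 0 w (lform (normals g_normals i))"
    unfolding all_less_10 lform_g vfield_simps
    by (simp flip: xyz) (simp add: w_def)
  moreover have "homogeneous 6 w"
    unfolding homogeneous_iff_dilate w_def xyz dilate_simps by algebra
  moreover have "vfield w 0 w (lform (normals g_normals 8)) = 0"
    by (simp add: lform_g vfield_simps)
  moreover have "w \<noteq> 0"
  proof
    assume "w = 0"
    then have "eval3 w (vector [2, 1, 1]) = 0" by simp
    then show False by (simp add: w_def xyz vector_3)
  qed
  ultimately show ?thesis
    using g.syzygy_of_logarithmic[of 5 w 0 w 8] by (simp add: homogeneous_0)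
qed

text \<open>
  Restricted to the line \<open>x = 0\<close>, the cubics become \<open>Q\<^sub>1 = -y (y + z) (y + 2z)\<close> and
  \<open>Q\<^sub>2 = -z (y + z) (3y + z)\<close>, so that the first relation forces \<open>s = c z (3y + z)\<close> and
  \<open>t = -c y (y + 2z)\<close> there for a constant \<open>c\<close>.  The lines \<open>z = 0\<close> and \<open>x + y = 0\<close> behave in the same
  way, with constants \<open>d\<close> and \<open>e\<close>.  Comparing the coefficients of \<open>s\<close> and \<open>t\<close> gives \<open>d = -c\<close>,
  \<open>d = 2e\<close> and \<open>c = e\<close>, hence \<open>c = d = e = 0\<close>, and then \<open>s = t = 0\<close>.  In the proof, these restrictions
  are encoded by values at zeros of \<open>Q\<^sub>1\<close> and \<open>Q\<^sub>2\<close> and at one further point of each line.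
\<close>

lemma quadratic_relations:
  assumes s: "homogeneous 2 s" and t: "homogeneous 2 t"
    and Q1: "Q1 = (var_x - var_y) * (var_y + var_z) * (var_x + var_y + 2 * var_z)"
    and Q2: "Q2 = (var_x - var_y - var_z) * (var_x - var_z) * (var_x - 3 * var_y - var_z)"
    and x: "var_x dvd Q1 * s + Q2 * t" and z: "var_z dvd Q1 * s - Q2 * t"
    and xy: "var_x + var_y dvd Q1 * s + 2 * (Q2 * t)"
  shows "s = 0 \<and> t = 0"
proof -
  obtain s1 s2 s3 s4 s5 s6 where s_eval: "\<And>v. eval3 s v = s1 * (v$1)\<^sup>2 + s2 * (v$1 * v$2)
      + s3 * (v$1 * v$3) + s4 * (v$2)\<^sup>2 + s5 * (v$2 * v$3) + s6 * (v$3)\<^sup>2"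
    and s_eq: "s = const3 s1 * var_x\<^sup>2 + const3 s2 * (var_x * var_y) + const3 s3 * (var_x * var_z)
      + const3 s4 * var_y\<^sup>2 + const3 s5 * (var_y * var_z) + const3 s6 * var_z\<^sup>2"
    using homogeneous_2_expand[OF s] by blast
  obtain t1 t2 t3 t4 t5 t6 where t_eval: "\<And>v. eval3 t v = t1 * (v$1)\<^sup>2 + t2 * (v$1 * v$2)
      + t3 * (v$1 * v$3) + t4 * (v$2)\<^sup>2 + t5 * (v$2 * v$3) + t6 * (v$3)\<^sup>2"
    and t_eq: "t = const3 t1 * var_x\<^sup>2 + const3 t2 * (var_x * var_y) + const3 t3 * (var_x * var_z)
      + const3 t4 * var_y\<^sup>2 + const3 t5 * (var_y * var_z) + const3 t6 * var_z\<^sup>2"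
    using homogeneous_2_expand[OF t] by blast
  note ev = Q1 Q2 s_eval t_eval vector_3
  have X: "eval3 (Q1 * s + Q2 * t) (vector [0, b, c]) = 0" for b c
    using eval3_dvd[OF x] by (simp add: vector_3)
  have Z: "eval3 (Q1 * s - Q2 * t) (vector [a, b, 0]) = 0" for a b
    using eval3_dvd[OF z] by (simp add: vector_3)
  have Y: "eval3 (Q1 * s + 2 * (Q2 * t)) (vector [- 1, 1, c]) = 0" for c
    using eval3_dvd[OF xy] by (simp add: vector_3)
  have "s4 = 0" using X[of 1 0] by (simp add: ev)
  moreover have "t6 = 0" using X[of 0 1] by (simp add: ev)
  moreover have "s4 - 3 * s5 + 9 * s6 = 0" using X[of 1 "-3"] by (simp add: ev) algebra
  moreover have "4 * t4 - 2 * t5 + t6 = 0" using X[of "-2" 1] by (simp add: ev) algebra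
  moreover have "3 * (s4 + s5 + s6) + 4 * (t4 + t5 + t6) = 0"
    using X[of 1 1] by (simp add: ev) algebra
  moreover have "t1 = 0" using Z[of 1 0] by (simp add: ev)
  moreover have "t1 - t2 + t4 = 0" using Z[of 1 "-1"] by (simp add: ev) algebra
  moreover have "9 * s1 + 3 * s2 + s4 = 0" using Z[of 3 1] by (simp add: ev) algebra
  moreover have "3 * (4 * s1 + 2 * s2 + s4) + 2 * (4 * t1 + 2 * t2 + t4) = 0"
    using Z[of 2 1] by (simp add: ev)
  moreover have "s1 - s2 + 2 * s3 + s4 - 2 * s5 + 4 * s6 = 0"
    using Y[of "-2"] by (simp add: ev) algebra
  moreover have "s1 - s2 + 4 * s3 + s4 - 4 * s5 + 16 * s6 = 0"
    using Y[of "-4"] by (simp add: ev) algebra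
  moreover have "4 * (s1 - s2 - s3 + s4 + s5 + s6) + 30 * (t1 - t2 - t3 + t4 + t5 + t6) = 0"
    using Y[of 1] by (simp add: ev) algebra
  ultimately have "s1 = 0" "s2 = 0" "s3 = 0" "s4 = 0" "s5 = 0" "s6 = 0"
    "t1 = 0" "t2 = 0" "t3 = 0" "t4 = 0" "t5 = 0" "t6 = 0"
    by algebra+
  then show ?thesis unfolding s_eq t_eq by (simp add: const3_simps)
qed

lemma AR_deg_g_5: "AR_deg g.poly_of 5 = {(0, 0, 0)}"
proof -
  define x y z where xyz: "x = var_x" "y = var_y" "z = var_z"
  have "(\<alpha>, \<beta>, \<gamma>) = (0, 0, 0)" if "(\<alpha>, \<beta>, \<gamma>) \<in> AR_deg g.poly_of 5" for \<alpha> \<beta> \<gamma>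
  proof -
    have AR: "(\<alpha>, \<beta>, \<gamma>) \<in> AR g.poly_of"
      and hom: "homogeneous 5 \<alpha>" "homogeneous 5 \<beta>" "homogeneous 5 \<gamma>"
      using that by (auto simp: AR_deg_def)
    obtain A where A: "\<alpha> - 2 * \<beta> - \<gamma> = (x - 2 * y - z) * A"
      using g.syzygy_dvd[OF AR, of 8] by (auto simp: lform_g vfield_simps dvd_def xyz)
    \<comment> \<open>Subtracting \<open>A E\<close> normalises the derivation to kill \<open>x - 2y - z\<close>.\<close>
    define a b c where abc: "a = \<alpha> - A * x" "b = \<beta> - A * y" "c = \<gamma> - A * z"
    have homA: "homogeneous 4 A"
    proof (rule homogeneous_cofactor)
      show "homogeneous 1 (x - 2 * y - z)" "x - 2 * y - z \<noteq> 0"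
        using homogeneous_lform[of "normals g_normals 8"] lform_eq_0_iff[of "normals g_normals 8"]
          g.nonzero[of 8] unfolding lform_g xyz by simp_all
      have "homogeneous (0 + 5) (2 * \<beta>)" by (intro homogeneous_mult homogeneous_numeral hom)
      then show "homogeneous (1 + 4) ((x - 2 * y - z) * A)"
        using hom unfolding A[symmetric] by (intro homogeneous_diff) simp_all
    qed
    have hom': "homogeneous 5 a" "homogeneous 5 b" "homogeneous 5 c"
      using hom homogeneous_mult[OF homA homogeneous_var(1)] homogeneous_mult[OF homA homogeneous_var(2)]
        homogeneous_mult[OF homA homogeneous_var(3)]
      by (simp_all add: abc xyz homogeneous_diff)
    have dvd: "lform (normals g_normals i) dvd vfield a b c (lform (normals g_normals i))"
      if "i < 10" for i
    proof -
      have "vfield a b c (lform w) = vfield \<alpha> \<beta> \<gamma> (lform w) - A * lform w" for w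
        by (simp add: abc xyz vfield_lform) (simp add: lform_def algebra_simps)
      then show ?thesis using g.syzygy_dvd[OF AR that] by simp
    qed
    have a: "a = 2 * b + c" using A unfolding abc by algebra
    define Q1 where "Q1 = (x - y) * (y + z) * (x + y + 2 * z)"
    define Q2 where "Q2 = (x - y - z) * (x - z) * (x - 3 * y - z)"
    have numeral_dvd: "l dvd h" if "l dvd numeral n * h" for l h :: poly3 and n
    proof -
      have "h = const3 (1 / numeral n) * (numeral n * h)"
        by (simp add: const3_simps(6)[symmetric] mult.assoc[symmetric] const3_simps(2)[symmetric])
          (simp add: const3_simps)
      with that show ?thesis by (metis dvd_mult)
    qed
    have "x - y dvd a - b" using dvd[of 2] by (simp add: lform_g vfield_simps xyz)
    moreover have "y + z dvd a - b"
      using dvd[of 5] by (simp add: lform_g vfield_simps xyz a)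
    moreover have "x + y + 2 * z dvd a - b"
    proof (rule numeral_dvd)
      show "x + y + 2 * z dvd 3 * (a - b)"
        using dvd[of 7] by (simp add: lform_g vfield_simps xyz a) (simp add: algebra_simps)
    qed
    ultimately have "(\<Prod>i\<in>{2, 5, 7}. lform (normals g_normals i)) dvd a - b"
      by (intro g.prod_lform_dvd) (auto simp: lform_g xyz)
    then obtain s where s: "a - b = Q1 * s"
      unfolding dvd_def by (auto simp: lform_g Q1_def xyz mult.assoc)
    have "x - y - z dvd b"
      using dvd[of 4] by (simp add: lform_g vfield_simps xyz a)
    moreover have "x - z dvd b"
    proof (rule numeral_dvd)
      show "x - z dvd 2 * b" using dvd[of 6] by (simp add: lform_g vfield_simps xyz a)
    qed
    moreover have "x - 3 * y - z dvd b"
      using dvd[of 9] by (simp add: lform_g vfield_simps xyz a)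
    ultimately have "(\<Prod>i\<in>{4, 6, 9}. lform (normals g_normals i)) dvd b"
      by (intro g.prod_lform_dvd) (auto simp: lform_g xyz)
    then obtain t where t: "b = Q2 * t"
      unfolding dvd_def by (auto simp: lform_g Q2_def xyz mult.assoc)
    have a': "a = Q1 * s + Q2 * t" and c': "c = Q1 * s - Q2 * t" using a s t by algebra+
    have "s = 0 \<and> t = 0"
    proof (rule quadratic_relations)
      show "Q1 = (var_x - var_y) * (var_y + var_z) * (var_x + var_y + 2 * var_z)"
        "Q2 = (var_x - var_y - var_z) * (var_x - var_z) * (var_x - 3 * var_y - var_z)"
        by (simp_all add: Q1_def Q2_def xyz)
      show "var_x dvd Q1 * s + Q2 * t"
        using dvd[of 0] by (simp add: lform_g vfield_simps a')
      show "var_z dvd Q1 * s - Q2 * t"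
        using dvd[of 1] by (simp add: lform_g vfield_simps c' del: One_nat_def)
      show "var_x + var_y dvd Q1 * s + 2 * (Q2 * t)"
        using dvd[of 3] by (simp add: lform_g vfield_simps a' t algebra_simps)
      have "homogeneous 3 Q1" "homogeneous 3 Q2"
        unfolding homogeneous_iff_dilate Q1_def Q2_def xyz dilate_simps by algebra+
      moreover have "Q1 \<noteq> 0" "Q2 \<noteq> 0"
      proof -
        have "eval3 Q1 (vector [1, 0, 2]) \<noteq> 0" "eval3 Q2 (vector [1, 0, 2]) \<noteq> 0"
          by (simp_all add: Q1_def Q2_def xyz vector_3)
        then show "Q1 \<noteq> 0" "Q2 \<noteq> 0" by auto
      qed
      moreover have "homogeneous (3 + 2) (Q1 * s)" "homogeneous (3 + 2) (Q2 * t)"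
        using hom' homogeneous_diff[OF hom'(1,2)] s t by simp_all
      ultimately show "homogeneous 2 s" "homogeneous 2 t" by (meson homogeneous_cofactor)+
    qed
    with s t a have 0: "a = 0" "b = 0" "c = 0" by auto
    \<comment> \<open>The syzygy is the multiple \<open>A E\<close> of the Euler derivation, and \<open>E(g) = 10 g\<close>.\<close>
    have "10 * A * g.poly_of = 0"
      using AR 0 g.vfield_euler[of A] by (simp add: AR_iff abc xyz)
    then have "A = 0" using g.poly_of_nonzero by simp
    with 0 show ?thesis by (simp add: abc)
  qed
  then show ?thesis using zero_in_AR_deg[of g.poly_of 5] by fast
qed

lemma mdr_g: "mdr g.poly_of = 6"
  unfolding mdr_def
proof (rule Least_equality)
  show "AR_deg g.poly_of 6 \<noteq> {(0, 0, 0)}" by (rule AR_deg_g_6)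
  show "6 \<le> q" if "AR_deg g.poly_of q \<noteq> {(0, 0, 0)}" for q
    using that AR_deg_antimono[OF AR_deg_g_5, of q] by linarith
qed

lemma mdr_f: "mdr f.poly_of \<le> 5"
  unfolding mdr_def by (rule Least_le) (rule AR_deg_f)

lemma maximal_tjurina_g: "maximal_tjurina_curve g.poly_of"
  by (simp add: maximal_tjurina_curve_def g.card_lines mdr_g tjurina_g choose_two)

text \<open>The condition \<open>2r \<ge> 10\<close> leaves only \<open>r = 5\<close>, where the Tjurina number would have to be \<open>60\<close>.\<close>

lemma not_maximal_tjurina_f: "\<not> maximal_tjurina_curve f.poly_of"
proof
  assume max: "maximal_tjurina_curve f.poly_of"
  then have "10 \<le> 2 * mdr f.poly_of"
    by (simp add: maximal_tjurina_curve_def Let_def f.card_lines)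
  with mdr_f have "mdr f.poly_of = 5" by simp
  with max show False
    by (simp add: maximal_tjurina_curve_def f.card_lines tjurina_f choose_two)
qed

theorem mainTheorem10:
  fixes x y z f g :: poly3
  assumes "x = var_x" and "y = var_y" and "z = var_z"
    and f: "f = (y - z) * (y + 2 * z) * (2 * y + z) * (x - 2 * y - z) * (x - y - 2 * z)
      * (x - y + z) * (x + y - z) * (x + y + 2 * z) * (2 * x - y - 2 * z) * (x - 3 * y - z)"
    and g: "g = x * z * (x - y) * (x + y) * (x - y - z) * (y + z) * (x - z)
      * (x + y + 2 * z) * (x - 2 * y - z) * (x - 3 * y - z)"
  shows "\<not> (\<forall>d d' h h'. line_arrangement d h \<longrightarrow> line_arrangement d' h' \<longrightarrow>
              isomorphic_lattices h h' \<longrightarrow>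
              (maximal_tjurina_curve h \<longleftrightarrow> maximal_tjurina_curve h')) \<and>
         line_arrangement 10 f \<and> line_arrangement 10 g \<and>
         isomorphic_lattices f g \<and>
         maximal_tjurina_curve g \<and> card (lines g) = 10 \<and> mdr g = 6 \<and>
         \<not> maximal_tjurina_curve f"
proof -
  have "f = f.poly_of" "g = g.poly_of"
    unfolding f g f_poly_of g_poly_of assms(1-3) by (rule refl)+
  then show ?thesis
    using f.line_arrangement_poly_of g.line_arrangement_poly_of isomorphic_f_g maximal_tjurina_g
      g.card_lines mdr_g not_maximal_tjurina_f
    by metis
qed

end
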